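(* Let $\beta\in\{1,2,4\}$, $N\ge1$ and $\nu_1,\dots,\nu_N>0$. Let $X$ be a random $N\times N$ matrix with real ($\beta=1$), complex ($\beta=2$) or quaternion ($\beta=4$) entries, with independent rows, the $l$-th row having the beta type I density $$\pi^{-\beta N/2}(\beta\nu_l/2)_{\beta N/2}(1-|\mathbf x|^2)^{\beta\nu_l/2-1}$$ on the unit ball of $\mathbb R^{\beta N}$. Let $\mu_1$ be the largest Lyapunov exponent of the product $P_m=X_mX_{m-1}\cdots X_1$ of independent copies $X_i$ of $X$. Then, with $\alpha_l=\beta(N+\nu_l-1)/2$, $$2\mu_1=\int_0^\infty\bigg(e^{-t}-\prod_{l=1}^N{}_1F_1\big(\beta/2,\ \beta/2+\alpha_l;\ -t\big)\bigg)\frac{dt}t.$$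
   Context: A row $\mathbf x=(x_1,\dots,x_N)$ is identified with a vector in $\mathbb R^{\beta N}$ (each entry has $\beta$ real components), $|x_i|^2$ is the sum of the squares of the real components of $x_i$, $|\mathbf x|^2=\sum_i|x_i|^2$, and densities are with respect to Lebesgue measure. $(c)_s=\Gamma(c+s)/\Gamma(c)$. ${}_1F_1(a,b;z)=\sum_{k\ge0}\frac{(a)_k}{(b)_k}\frac{z^k}{k!}$ is the confluent hypergeometric function. The largest Lyapunov exponent is the almost surely constant quantity $\mu_1=\sup_{y\ne0}\lim_{m\to\infty}\frac1m\log\|P_my\|$, the supremum being over nonzero column vectors $y$ with entries in the corresponding number system and $\|\cdot\|$ the Euclidean norm ($\|y\|^2$ is the sum of the squares of all real components of $y$). Equivalently, by Oseledec's theorem, $e^{\mu_1}$ is the largest eigenvalue of $\lim_{m\to\infty}(P_m^\dagger P_m)^{1/2m}$. *)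

theory Defs
  imports "HOL-Probability.Probability"
begin

section \<open>Quaternions\<close>

datatype quat = Quat (qRe: real) (qI: real) (qJ: real) (qK: real)

lemma quat_eq_iff:
  "p = q \<longleftrightarrow> qRe p = qRe q \<and> qI p = qI q \<and> qJ p = qJ q \<and> qK p = qK q"
  by (cases p; cases q) simp

instantiation quat :: ring_1
begin

definition zero_quat :: quat
  where "0 = Quat 0 0 0 0"

definition one_quat :: quat
  where "1 = Quat 1 0 0 0"

definition plus_quat :: "quat \<Rightarrow> quat \<Rightarrow> quat"
  where "p + q = Quat (qRe p + qRe q) (qI p + qI q) (qJ p + qJ q) (qK p + qK q)"

definition minus_quat :: "quat \<Rightarrow> quat \<Rightarrow> quat"
  where "p - q = Quat (qRe p - qRe q) (qI p - qI q) (qJ p - qJ q) (qK p - qK q)"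

definition uminus_quat :: "quat \<Rightarrow> quat"
  where "- p = Quat (- qRe p) (- qI p) (- qJ p) (- qK p)"

definition times_quat :: "quat \<Rightarrow> quat \<Rightarrow> quat"
  where "p * q = Quat
    (qRe p * qRe q - qI p * qI q - qJ p * qJ q - qK p * qK q)
    (qRe p * qI q + qI p * qRe q + qJ p * qK q - qK p * qJ q)
    (qRe p * qJ q - qI p * qK q + qJ p * qRe q + qK p * qI q)
    (qRe p * qK q + qI p * qJ q - qJ p * qI q + qK p * qRe q)"

instance
  by standard
    (simp_all add: quat_eq_iff zero_quat_def one_quat_def plus_quat_def minus_quat_def
      uminus_quat_def times_quat_def algebra_simps)

end

lemma quat_zero_sel [simp]: "qRe 0 = 0" "qI 0 = 0" "qJ 0 = 0" "qK 0 = 0"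
  by (simp_all add: zero_quat_def)

lemma quat_one_sel [simp]: "qRe 1 = 1" "qI 1 = 0" "qJ 1 = 0" "qK 1 = 0"
  by (simp_all add: one_quat_def)

lemma quat_plus_sel [simp]:
  "qRe (p + q) = qRe p + qRe q" "qI (p + q) = qI p + qI q"
  "qJ (p + q) = qJ p + qJ q" "qK (p + q) = qK p + qK q"
  by (simp_all add: plus_quat_def)

lemma quat_minus_sel [simp]:
  "qRe (p - q) = qRe p - qRe q" "qI (p - q) = qI p - qI q"
  "qJ (p - q) = qJ p - qJ q" "qK (p - q) = qK p - qK q"
  by (simp_all add: minus_quat_def)

lemma quat_uminus_sel [simp]:
  "qRe (- p) = - qRe p" "qI (- p) = - qI p" "qJ (- p) = - qJ p" "qK (- p) = - qK p"
  by (simp_all add: uminus_quat_def)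

lemma quat_times_sel [simp]:
  "qRe (p * q) = qRe p * qRe q - qI p * qI q - qJ p * qJ q - qK p * qK q"
  "qI (p * q) = qRe p * qI q + qI p * qRe q + qJ p * qK q - qK p * qJ q"
  "qJ (p * q) = qRe p * qJ q - qI p * qK q + qJ p * qRe q + qK p * qI q"
  "qK (p * q) = qRe p * qK q + qI p * qJ q - qJ p * qI q + qK p * qRe q"
  by (simp_all add: times_quat_def)

instantiation quat :: real_algebra_1
begin

definition scaleR_quat :: "real \<Rightarrow> quat \<Rightarrow> quat"
  where "scaleR r p = Quat (r * qRe p) (r * qI p) (r * qJ p) (r * qK p)"

instance
  by standard (simp_all add: quat_eq_iff scaleR_quat_def algebra_simps)

end

lemma quat_scaleR_sel [simp]:
  "qRe (r *\<^sub>R p) = r * qRe p" "qI (r *\<^sub>R p) = r * qI p"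
  "qJ (r *\<^sub>R p) = r * qJ p" "qK (r *\<^sub>R p) = r * qK p"
  by (simp_all add: scaleR_quat_def)

instantiation quat :: real_inner
begin

definition inner_quat :: "quat \<Rightarrow> quat \<Rightarrow> real"
  where "inner p q = qRe p * qRe q + qI p * qI q + qJ p * qJ q + qK p * qK q"

definition norm_quat :: "quat \<Rightarrow> real"
  where "norm p = sqrt ((qRe p)\<^sup>2 + (qI p)\<^sup>2 + (qJ p)\<^sup>2 + (qK p)\<^sup>2)"

definition sgn_quat :: "quat \<Rightarrow> quat"
  where "sgn p = p /\<^sub>R norm p" for p :: quat

definition dist_quat :: "quat \<Rightarrow> quat \<Rightarrow> real"
  where "dist p q = norm (p - q)" for p q :: quat

definition uniformity_quat :: "(quat \<times> quat) filter"
  where [code del]: "uniformity_quat = (INF e\<in>{0 <..}. principal {(x, y). dist x y < e})"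

definition open_quat :: "quat set \<Rightarrow> bool"
  where [code del]:
    "open_quat U \<longleftrightarrow> (\<forall>x\<in>U. eventually (\<lambda>(x', y). x' = x \<longrightarrow> y \<in> U) uniformity)"

instance
proof
  fix p q s :: quat and a b :: real and U :: "quat set"
  show "inner p p = 0 \<longleftrightarrow> p = 0"
  proof
    assume "inner p p = 0"
    then have *: "(qRe p)\<^sup>2 + (qI p)\<^sup>2 + (qJ p)\<^sup>2 + (qK p)\<^sup>2 = 0"
      by (simp add: inner_quat_def power2_eq_square)
    have "(qRe p)\<^sup>2 = 0 \<and> (qI p)\<^sup>2 = 0 \<and> (qJ p)\<^sup>2 = 0 \<and> (qK p)\<^sup>2 = 0"
      using * zero_le_power2[of "qRe p"] zero_le_power2[of "qI p"]
        zero_le_power2[of "qJ p"] zero_le_power2[of "qK p"] by linarith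
    then show "p = 0"
      by (simp add: quat_eq_iff)
  qed (simp add: inner_quat_def)
qed (simp_all add: quat_eq_iff scaleR_quat_def inner_quat_def norm_quat_def sgn_quat_def
    dist_quat_def uniformity_quat_def open_quat_def power2_eq_square algebra_simps)

end

lemma quat_norm_eq_0:
  "(qRe p)\<^sup>2 + (qI p)\<^sup>2 + (qJ p)\<^sup>2 + (qK p)\<^sup>2 = 0 \<longleftrightarrow> p = 0"
  using inner_eq_zero_iff[of p] by (simp add: inner_quat_def power2_eq_square)

instantiation quat :: real_normed_div_algebra
begin

definition inverse_quat :: "quat \<Rightarrow> quat"
  where "inverse p =
    Quat (qRe p) (- qI p) (- qJ p) (- qK p) /\<^sub>R
      ((qRe p)\<^sup>2 + (qI p)\<^sup>2 + (qJ p)\<^sup>2 + (qK p)\<^sup>2)"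

definition divide_quat :: "quat \<Rightarrow> quat \<Rightarrow> quat"
  where "p div q = p * inverse q" for p q :: quat

instance
proof
  fix p q :: quat
  show "inverse (0::quat) = 0"
    by (simp add: inverse_quat_def)
  show "p div q = p * inverse q"
    by (simp add: divide_quat_def)
  show "norm (p * q) = norm p * norm q"
    unfolding norm_quat_def real_sqrt_mult[symmetric]
    by (rule arg_cong[where f = sqrt]) (simp add: power2_eq_square algebra_simps)
  assume "p \<noteq> 0"
  then have nz: "(qRe p)\<^sup>2 + (qI p)\<^sup>2 + (qJ p)\<^sup>2 + (qK p)\<^sup>2 \<noteq> 0"
    by (simp add: quat_norm_eq_0)
  let ?c = "Quat (qRe p) (- qI p) (- qJ p) (- qK p)"
  let ?n = "(qRe p)\<^sup>2 + (qI p)\<^sup>2 + (qJ p)\<^sup>2 + (qK p)\<^sup>2"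
  have "?c * p = ?n *\<^sub>R 1" "p * ?c = ?n *\<^sub>R 1"
    by (simp_all add: quat_eq_iff power2_eq_square)
  then show "inverse p * p = 1" "p * inverse p = 1"
    unfolding inverse_quat_def mult_scaleR_left mult_scaleR_right
    using nz by simp_all
qed

end

instantiation quat :: euclidean_space
begin

definition Basis_quat :: "quat set"
  where "Basis = {Quat 1 0 0 0, Quat 0 1 0 0, Quat 0 0 1 0, Quat 0 0 0 1}"

instance
proof
  fix u v :: quat
  show "finite (Basis::quat set)" by (simp add: Basis_quat_def)
  show "(Basis::quat set) \<noteq> {}" by (simp add: Basis_quat_def)
  assume u: "u \<in> Basis" and v: "v \<in> Basis"
  from u have u': "u = Quat 1 0 0 0 \<or> u = Quat 0 1 0 0 \<or> u = Quat 0 0 1 0 \<or> u = Quat 0 0 0 1"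
    unfolding Basis_quat_def by blast
  from v have v': "v = Quat 1 0 0 0 \<or> v = Quat 0 1 0 0 \<or> v = Quat 0 0 1 0 \<or> v = Quat 0 0 0 1"
    unfolding Basis_quat_def by blast
  from u' v' show "inner u v = (if u = v then 1 else 0)"
    by (elim disjE) (simp_all add: inner_quat_def)
next
  fix p :: quat
  show "(\<forall>u\<in>Basis. inner p u = 0) \<longleftrightarrow> p = 0"
    unfolding Basis_quat_def inner_quat_def quat_eq_iff[of p] by simp
qed

end

lemma DIM_quat [simp]: "DIM(quat) = 4"
  by (simp add: Basis_quat_def)


section \<open>Random matrices with beta type I rows\<close>

text \<open>
  Entries have type \<open>'a\<close>, to be instantiated with \<^typ>\<open>real\<close>, \<^typ>\<open>complex\<close> or \<^typ>\<open>quat\<close>, and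
  \<open>\<beta>\<close> with \<open>DIM('a)\<close>. The norm and \<^const>\<open>lborel\<close> on \<open>'a ^ 'n\<close> are those of the Euclidean space of
  dimension \<open>DIM('a) * CARD('n)\<close> spanned by the real components of the entries.
\<close>

text \<open>The symbol \<open>(c)\<^sub>s\<close> for real \<open>s\<close>; \<^const>\<open>pochhammer\<close> only covers \<open>s \<in> \<nat>\<close>.\<close>

definition gamma_ratio :: "real \<Rightarrow> real \<Rightarrow> real"
  where "gamma_ratio c s = Gamma (c + s) / Gamma c"

definition beta_I_density ::
    "real \<Rightarrow> real \<Rightarrow> 'a::{real_normed_div_algebra, euclidean_space} ^ 'n \<Rightarrow> real"
  where "beta_I_density \<beta> \<nu> x =
    (if norm x < 1
     then pi powr (- (\<beta> * real CARD('n) / 2)) * gamma_ratio (\<beta> * \<nu> / 2) (\<beta> * real CARD('n) / 2)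
       * (1 - (norm x)\<^sup>2) powr (\<beta> * \<nu> / 2 - 1)
     else 0)"

definition beta_I_matrix ::
    "'w measure \<Rightarrow> real \<Rightarrow> ('n \<Rightarrow> real)
      \<Rightarrow> ('w \<Rightarrow> 'a::{real_normed_div_algebra, euclidean_space} ^ 'n ^ 'n) \<Rightarrow> bool"
  where "beta_I_matrix M \<beta> \<nu> X \<longleftrightarrow>
    prob_space.indep_vars M (\<lambda>_. borel) (\<lambda>l \<omega>. X \<omega> $ l) UNIV \<and>
    (\<forall>l. distributed M lborel (\<lambda>\<omega>. X \<omega> $ l) (\<lambda>x. ennreal (beta_I_density \<beta> (\<nu> l) x)))"

text \<open>
  \<open>X i\<close> is the \<open>(i + 1)\<close>-st factor. The condition on each \<open>X i\<close> determines its law,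
  so the factors are identically distributed.
\<close>

definition iid_beta_I_matrices ::
    "'w measure \<Rightarrow> real \<Rightarrow> ('n \<Rightarrow> real)
      \<Rightarrow> (nat \<Rightarrow> 'w \<Rightarrow> 'a::{real_normed_div_algebra, euclidean_space} ^ 'n ^ 'n) \<Rightarrow> bool"
  where "iid_beta_I_matrices M \<beta> \<nu> X \<longleftrightarrow>
    prob_space.indep_vars M (\<lambda>_. borel) X UNIV \<and> (\<forall>i. beta_I_matrix M \<beta> \<nu> (X i))"


section \<open>Largest Lyapunov exponent\<close>

primrec matrix_prod :: "(nat \<Rightarrow> 'a::semiring_1 ^ 'n ^ 'n) \<Rightarrow> nat \<Rightarrow> 'a ^ 'n ^ 'n"
  where
    "matrix_prod A 0 = mat 1"
  | "matrix_prod A (Suc m) = A m ** matrix_prod A m"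

text \<open>Extended-real valued, since \<^term>\<open>ln 0 = (0::real)\<close> in the library.\<close>

definition log_norm :: "'v::real_normed_vector \<Rightarrow> ereal"
  where "log_norm y = (if y = 0 then - \<infinity> else ereal (ln (norm y)))"

text \<open>
  The supremum over \<open>y \<noteq> 0\<close> of \<open>lim\<^sub>m (1/m) log \<parallel>P\<^sub>m y\<parallel>\<close>, written as the supremum of the set of these
  limits. By Oseledec's theorem the limit almost surely exists for every \<open>y\<close>.
\<close>

definition max_growth_rate ::
    "(nat \<Rightarrow> 'a::{real_normed_div_algebra, euclidean_space} ^ 'n ^ 'n) \<Rightarrow> ereal"
  where "max_growth_rate A =
    Sup {L. \<exists>y. y \<noteq> 0 \<and> (\<lambda>m. log_norm (matrix_prod A m *v y) / ereal (real m)) \<longlonglongrightarrow> L}"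

definition has_largest_lyapunov_exponent ::
    "'w measure \<Rightarrow> (nat \<Rightarrow> 'w \<Rightarrow> 'a::{real_normed_div_algebra, euclidean_space} ^ 'n ^ 'n)
      \<Rightarrow> real \<Rightarrow> bool"
  where "has_largest_lyapunov_exponent M X \<mu> \<longleftrightarrow>
    (AE \<omega> in M. max_growth_rate (\<lambda>i. X i \<omega>) = ereal \<mu>)"


section \<open>The integrand\<close>

definition hyp_1F1 :: "real \<Rightarrow> real \<Rightarrow> real \<Rightarrow> real"
  where "hyp_1F1 a b z = (\<Sum>k. pochhammer a k / pochhammer b k * (z ^ k / fact k))"

definition lyapunov_integrand :: "real \<Rightarrow> ('n::finite \<Rightarrow> real) \<Rightarrow> real \<Rightarrow> real"
  where "lyapunov_integrand \<beta> \<nu> t =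
    (let \<alpha> = \<lambda>l. \<beta> * (real CARD('n) + \<nu> l - 1) / 2
     in (exp (- t) - (\<Prod>l\<in>UNIV. hyp_1F1 (\<beta> / 2) (\<beta> / 2 + \<alpha> l) (- t))) / t)"

end

theory Submission
  imports Defs
begin

text \<open>
  Each row law is radial, so \<open>\<parallel>X e\<parallel>\<close> has the same law for every unit vector \<open>e\<close>. Hence for fixed \<open>y\<close>
  the increments of \<open>log \<parallel>P\<^sub>m y\<parallel>\<close> are independent and identically distributed, and the strong law of large
  numbers gives \<open>log \<parallel>P\<^sub>m y\<parallel> / m \<longlonglongrightarrow> E log \<parallel>X e\<parallel>\<close>. Applied to the finitely many basis vectors, this also
  bounds the growth of \<open>P\<^sub>m y\<close> for all \<open>y\<close> simultaneously, so \<open>2 \<mu>\<^sub>1 = E log W\<close> with \<open>W = \<parallel>X e\<parallel>\<^sup>2\<close>. By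
  Frullani's formula \<open>log w = \<integral>\<^sub>0 (exp (-t) - exp (-t w)) dt/t\<close>, this is determined by the Laplace transform of
  \<open>W\<close>, which factors over the independent rows. Each factor is a confluent hypergeometric function because the
  moments of \<open>|x\<^sub>1|\<^sup>2\<close> under a beta type I density are quotients of Pochhammer symbols.
\<close>

section \<open>Coisometries and rotation invariance of Lebesgue measure\<close>

text \<open>Real, complex and quaternion entries are treated at once: only the structure of a normed
  division algebra of finite real dimension is used. It makes multiplication of rows by a unit
  column \<open>e\<close> a coisometry of real Euclidean spaces, and all coisometries between two
  given spaces agree up to an orthogonal map.

  No beta integral is evaluated. A row law has mass one by hypothesis, and consecutive moments are
  compared through Gaussian ones, where rescaling a single entry gives a recursion. The same
  recursion, used once at a negative exponent, bounds the row entries near 0; this gives the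
  logarithm a finite fourth moment, and a fourth moment turns the strong law into a summability
  argument.

  The direction of \<open>P_m y\<close> depends on the past, but the law of \<open>|X e|\<close> is
  the same for every unit \<open>e\<close>. Conditioning on the current vector therefore shows that
  the next increment is independent of it. The moment estimate needs no more than this: independence
  of each increment from the partial sum before it.\<close>

lemma inner_mult_right_same:
  fixes a b c :: "'a::{real_normed_div_algebra, real_inner}"
  shows "(a * c) \<bullet> (b * c) = (norm c)\<^sup>2 * (a \<bullet> b)"
proof -
  \<comment> \<open>Polarisation: the inner product is read off from the norm of a sum, and the norm
    is multiplicative.\<close>
  have "(norm (a * c + b * c))\<^sup>2 = (norm (a + b))\<^sup>2 * (norm c)\<^sup>2"
    by (metis distrib_right norm_mult power_mult_distrib)
  then have "(norm (a*c))\<^sup>2 + (norm (b*c))\<^sup>2 + 2 * ((a * c) \<bullet> (b * c))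
      = ((norm a)\<^sup>2 + (norm b)\<^sup>2 + 2 * (a \<bullet> b)) * (norm c)\<^sup>2"
    using dot_norm[of "a * c" "b * c"] dot_norm[of a b] by (simp add: field_simps)
  then show ?thesis
    by (simp add: norm_mult power_mult_distrib algebra_simps)
qed

lemma power2_norm_vec:
  fixes x :: "'a::real_inner ^ 'n"
  shows "(norm x)\<^sup>2 = (\<Sum>i\<in>UNIV. (norm (x $ i))\<^sup>2)"
  by (simp add: power2_norm_eq_inner inner_vec_def)

definition row_mult :: "'a::semiring_0 ^ 'n \<Rightarrow> 'a ^ 'n \<Rightarrow> 'a"
  where "row_mult x y = (\<Sum>j\<in>UNIV. x $ j * y $ j)"

text \<open>The adjoint with respect to the real inner product; for real, complex and quaternion entries
  \<open>|c|\<^sup>2 c\<inverse>\<close> is the conjugate of \<open>c\<close>.\<close>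

definition row_mult_adj :: "'a::{real_normed_div_algebra} ^ 'n \<Rightarrow> 'a \<Rightarrow> 'a ^ 'n"
  where "row_mult_adj y a = (\<chi> j. (norm (y $ j))\<^sup>2 *\<^sub>R (a * inverse (y $ j)))"

lemma matrix_vector_mult_row_mult: "(A *v y) $ l = row_mult (A $ l) y"
  by (simp add: matrix_vector_mult_def row_mult_def)

lemma linear_row_mult: "linear (\<lambda>x. row_mult x y)"
  for y :: "'a::real_normed_div_algebra ^ 'n"
  by (rule linearI)
    (simp_all add: row_mult_def distrib_right sum.distrib scaleR_sum_right)

lemma linear_row_mult_adj: "linear (row_mult_adj y)"
  for y :: "'a::real_normed_div_algebra ^ 'n"
  by (rule linearI) (simp_all add: row_mult_adj_def vec_eq_iff distrib_right algebra_simps)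

lemma inner_row_mult_adj:
  fixes y :: "'a::{real_normed_div_algebra, euclidean_space} ^ 'n"
  shows "row_mult x y \<bullet> a = x \<bullet> row_mult_adj y a"
proof -
  have "(x $ j * y $ j) \<bullet> a = x $ j \<bullet> ((norm (y $ j))\<^sup>2 *\<^sub>R (a * inverse (y $ j)))" for j
  proof (cases "y $ j = 0")
    case False
    \<comment> \<open>Writing \<open>a\<close> as a right multiple of \<open>y $ j\<close> gives
      both arguments the same right factor.\<close>
    have "(x $ j * y $ j) \<bullet> a = (x $ j * y $ j) \<bullet> (a * inverse (y $ j) * y $ j)"
      using False by (simp add: mult.assoc)
    also have "\<dots> = (norm (y $ j))\<^sup>2 * (x $ j \<bullet> (a * inverse (y $ j)))"
      by (rule inner_mult_right_same)
    finally show ?thesis by simp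
  qed simp
  then show ?thesis
    by (simp add: row_mult_def row_mult_adj_def inner_vec_def inner_sum_left)
qed

text \<open>For a unit vector \<open>y\<close> the adjoint is thus a right inverse, that is,
  multiplying rows by \<open>y\<close> is a coisometry.\<close>

lemma row_mult_row_mult_adj:
  fixes y :: "'a::{real_normed_div_algebra, euclidean_space} ^ 'n"
  shows "row_mult (row_mult_adj y a) y = (norm y)\<^sup>2 *\<^sub>R a"
proof -
  have "row_mult_adj y a $ j * y $ j = (norm (y $ j))\<^sup>2 *\<^sub>R a" for j
    by (cases "y $ j = 0") (simp_all add: row_mult_adj_def mult.assoc)
  then show ?thesis
    by (simp add: row_mult_def power2_norm_vec scaleR_sum_left)
qed

text \<open>A coisometry is isometric on the range of its adjoint and zero on the orthogonal
  complement. The two kernels therefore have equal dimension, and \<open>T\<close> glues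
  \<open>Ps\<close> after \<open>L\<close> on the first part to an isometry of the kernels on the
  second.\<close>

lemma coisometries_conjugate:
  fixes L P :: "'v::euclidean_space \<Rightarrow> 'a::euclidean_space"
  assumes L: "linear L" "linear Ls" "\<And>x a. L x \<bullet> a = x \<bullet> Ls a" "\<And>a. L (Ls a) = a"
    and P: "linear P" "linear Ps" "\<And>x a. P x \<bullet> a = x \<bullet> Ps a" "\<And>a. P (Ps a) = a"
  obtains T where "orthogonal_transformation T" "\<And>x. P (T x) = L x"
proof -
  have ker: "dim {x. L x = 0} + DIM('a) = DIM('v)"
    if "linear L" "linear Ls" "\<And>x a. L x \<bullet> a = x \<bullet> Ls a" "\<And>a. L (Ls a) = a"
    for L :: "'v \<Rightarrow> 'a" and Ls
  proof -
    have "inj Ls" by (metis that(4) injI)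
    \<comment> \<open>The kernel is the orthogonal complement of \<open>range Ls\<close>, whose
      dimension is \<open>DIM('a)\<close> by injectivity of \<open>Ls\<close>.\<close>
    have "L x = 0 \<longleftrightarrow> (\<forall>y\<in>range Ls. orthogonal y x)" for x
      unfolding orthogonal_def
      by (metis that(3) inner_commute inner_eq_zero_iff inner_zero_left rangeE rangeI)
    then have eq: "{x. L x = 0} = {x \<in> UNIV. \<forall>y\<in>range Ls. orthogonal y x}" by auto
    have "dim (range Ls) = DIM('a)"
      using \<open>inj Ls\<close> that(2) by (simp add: dim_image_eq)
    then show ?thesis
      using dim_subspace_orthogonal_to_vectors[of "range Ls" UNIV] that(2)
      unfolding eq by (simp add: linear_subspace_image)
  qed
  have "dim {x. L x = 0} = dim {x. P x = 0}"
    using ker[OF L] ker[OF P] by simp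
  moreover have "subspace {x. L x = 0}" "subspace {x. P x = 0}"
    using L(1) P(1) by (simp_all add: linear_subspace_kernel)
  ultimately obtain f where f: "linear f" "f ` {x. L x = 0} = {x. P x = 0}"
      "\<And>x. x \<in> {x. L x = 0} \<Longrightarrow> norm (f x) = norm x"
    using isometry_subspaces by metis
  define T where "T x = Ps (L x) + f (x - Ls (L x))" for x
  have linT: "linear T"
    by (rule linearI)
      (simp_all add: T_def linear_add[OF L(1)] linear_add[OF L(2)] linear_add[OF P(2)] linear_add[OF f(1)]
        linear_diff[OF f(1)] linear_scale[OF L(1)] linear_scale[OF L(2)] linear_scale[OF P(2)]
        linear_scale[OF f(1)] algebra_simps)
  have Pf: "P (f (x - Ls (L x))) = 0" for x
  proof -
    have "x - Ls (L x) \<in> {x. L x = 0}" using L by (simp add: linear_diff)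
    then show ?thesis using f(2) by blast
  qed
  have PT: "P (T x) = L x" for x
    using P by (simp add: T_def linear_add Pf)
  have "norm (T x) = norm x" for x
  proof -
    \<comment> \<open>Pythagoras: one summand of \<open>T x\<close> lies in the range of
      \<open>Ps\<close>, the other in the kernel of \<open>P\<close>.\<close>
    have "(norm (T x))\<^sup>2 = (norm (Ps (L x)))\<^sup>2 + (norm (f (x - Ls (L x))))\<^sup>2
        + 2 * (f (x - Ls (L x)) \<bullet> Ps (L x))"
      using dot_norm[of "f (x - Ls (L x))" "Ps (L x)"] by (simp add: T_def add.commute)
    also have "f (x - Ls (L x)) \<bullet> Ps (L x) = 0"
      using P(3)[of "f (x - Ls (L x))" "L x"] by (simp add: Pf)
    also have "norm (f (x - Ls (L x))) = norm (x - Ls (L x))"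
      using L by (intro f(3)) (simp add: linear_diff)
    also have "(norm (Ps (L x)))\<^sup>2 = (norm (L x))\<^sup>2"
      using P(3)[of "Ps (L x)" "L x"] P(4) by (simp add: power2_norm_eq_inner)
    also have "(norm (x - Ls (L x)))\<^sup>2 = (norm x)\<^sup>2 - (norm (L x))\<^sup>2"
      using L(3)[of "Ls (L x)" "L x"] L(3)[of x "L x"] L(4)
      by (simp add: power2_norm_eq_inner inner_diff inner_commute)
    finally show ?thesis by (simp add: power2_eq_iff_nonneg)
  qed
  with linT have "orthogonal_transformation T"
    by (simp add: orthogonal_transformation)
  then show ?thesis using PT by (rule that)
qed

text \<open>Reading off entry \<open>i\<close> is multiplication by the unit column
  \<open>axis i 1\<close>, so both maps are coisometries onto \<open>'a\<close>.\<close>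

lemma row_mult_orthogonal:
  fixes y :: "'a::{real_normed_div_algebra, euclidean_space} ^ 'n"
  assumes "norm y = 1"
  obtains T :: "'a ^ 'n \<Rightarrow> 'a ^ 'n"
    where "orthogonal_transformation T" "\<And>x. T x $ i = row_mult x y"
proof -
  have "norm (axis i (1::'a)) = 1"
    by (simp add: norm_eq_sqrt_inner inner_axis_axis) (simp add: power2_norm_eq_inner[symmetric])
  have eq: "row_mult x (axis i (1::'a)) = x $ i" for x :: "'a^'n"
    by (simp add: row_mult_def axis_def if_distrib[where f="\<lambda>z. _ * z"] cong: if_cong)
  show ?thesis
  proof (rule coisometries_conjugate[of "\<lambda>x. row_mult x y" "row_mult_adj y"
      "\<lambda>x. row_mult x (axis i (1::'a))" "row_mult_adj (axis i 1)"])
    show "row_mult (row_mult_adj (axis i 1) a) (axis i 1) = a" for a :: 'a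
      by (simp only: row_mult_row_mult_adj \<open>norm (axis i (1::'a)) = 1\<close>) simp
    fix T :: "'a ^ 'n \<Rightarrow> 'a ^ 'n"
    assume "orthogonal_transformation T" "\<And>x. row_mult (T x) (axis i 1) = row_mult x y"
    then show thesis using that by (simp add: eq)
  qed (simp_all add: linear_row_mult linear_row_mult_adj inner_row_mult_adj
      row_mult_row_mult_adj assms)
qed

text \<open>The image measure is translation invariant. Comparing it with Lebesgue measure by Tonelli, weighted by the
  indicator of a ball, shows that the two are proportional, and the ball itself fixes the constant.\<close>

lemma lborel_distr_orthogonal:
  fixes T :: "'v::euclidean_space \<Rightarrow> 'v"
  assumes T: "orthogonal_transformation T"
  shows "distr lborel borel T = lborel"
proof (rule measure_eqI)
  show "sets (distr lborel borel T) = sets (lborel :: 'v measure)" by simp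
  have lin: "linear T" and nrm: "\<And>x. norm (T x) = norm x"
    using T by (auto simp: orthogonal_transformation)
  have [measurable]: "T \<in> borel_measurable borel"
    using lin by (simp add: borel_measurable_continuous_onI linear_continuous_on linear_conv_bounded_linear)
  define B :: "'v set" where "B = ball 0 1"
  have [measurable]: "B \<in> sets borel" by (simp add: B_def)
  have preserved: "(\<integral>\<^sup>+x. indicator B (T x - T y) \<partial>lborel) = emeasure lborel B" for y
  proof -
    have "(\<integral>\<^sup>+x. indicator B (T x - T y) \<partial>lborel) = (\<integral>\<^sup>+x. indicator B (-y + x) \<partial>lborel)"
      by (intro nn_integral_cong)
        (simp add: B_def indicator_def linear_diff[OF lin, symmetric] nrm)
    also have "\<dots> = (\<integral>\<^sup>+x. indicator B x \<partial>distr lborel borel (\<lambda>x. -y + x))"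
      by (subst nn_integral_distr) auto
    also have "distr lborel borel (\<lambda>x. -y + x) = lborel"
      by (rule lborel_distr_plus)
    finally show ?thesis by simp
  qed
  fix A :: "'v set" assume "A \<in> sets (distr lborel borel T)"
  then have [measurable]: "A \<in> sets borel" by simp
  have shift: "(\<integral>\<^sup>+x. f (y + x) \<partial>lborel) = (\<integral>\<^sup>+x. f x \<partial>lborel)"
    if [measurable]: "f \<in> borel_measurable borel" for f :: "'v \<Rightarrow> ennreal" and y :: 'v
  proof -
    have "(\<integral>\<^sup>+x. f (y + x) \<partial>lborel) = (\<integral>\<^sup>+x. f x \<partial>distr lborel borel (\<lambda>x. y + x))"
      by (subst nn_integral_distr) auto
    then show ?thesis by (simp add: lborel_distr_plus)
  qed
  have surjT: "surj T" using T by (rule orthogonal_transformation_surj)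
  have "emeasure (distr lborel borel T) A * emeasure lborel B
      = (\<integral>\<^sup>+x. indicator A (T x) \<partial>lborel) * (\<integral>\<^sup>+y. indicator B y \<partial>lborel)"
    using nn_integral_distr[of T lborel borel "indicator A"] by simp
  also have "\<dots> = (\<integral>\<^sup>+y. (\<integral>\<^sup>+x. indicator A (T x) \<partial>lborel) * indicator B y \<partial>lborel)"
    by (simp add: nn_integral_cmult)
  \<comment> \<open>Since \<open>T\<close> is onto, \<open>y = T z\<close> for some
    \<open>z\<close>; moving \<open>x\<close> by \<open>z\<close> moves \<open>T x\<close> by
    \<open>y\<close>.\<close>
  also have "\<dots> = (\<integral>\<^sup>+y. (\<integral>\<^sup>+x. indicator A (T x + y) \<partial>lborel) * indicator B y \<partial>lborel)"
  proof (rule nn_integral_cong)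
    fix y
    obtain z where z: "y = T z" using surjT by auto
    have "(\<integral>\<^sup>+x. indicator A (T x) \<partial>lborel) = (\<integral>\<^sup>+x. indicator A (T x + y) \<partial>lborel)"
      using shift[of "\<lambda>x. indicator A (T x)" z]
      by (simp add: z linear_add[OF lin] add.commute)
    then show "(\<integral>\<^sup>+x. indicator A (T x) \<partial>lborel) * indicator B y
        = (\<integral>\<^sup>+x. indicator A (T x + y) \<partial>lborel) * indicator B y" by simp
  qed
  also have "\<dots> = (\<integral>\<^sup>+y. (\<integral>\<^sup>+x. indicator A (T x + y) * indicator B y \<partial>lborel) \<partial>lborel)"
    by (simp add: nn_integral_multc)
  also have "\<dots> = (\<integral>\<^sup>+x. (\<integral>\<^sup>+y. indicator A (T x + y) * indicator B y \<partial>lborel) \<partial>lborel)"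
    by (rule lborel_pair.Fubini') simp
  also have "\<dots> = (\<integral>\<^sup>+x. (\<integral>\<^sup>+y. indicator A y * indicator B (y - T x) \<partial>lborel) \<partial>lborel)"
  proof (rule nn_integral_cong)
    show "(\<integral>\<^sup>+y. indicator A (T x + y) * indicator B y \<partial>lborel)
        = (\<integral>\<^sup>+y. indicator A y * indicator B (y - T x) \<partial>lborel)" for x
      using shift[of "\<lambda>y. indicator A y * indicator B (y - T x)" "T x"] by simp
  qed
  also have "\<dots> = (\<integral>\<^sup>+y. (\<integral>\<^sup>+x. indicator A y * indicator B (y - T x) \<partial>lborel) \<partial>lborel)"
    by (rule lborel_pair.Fubini') simp
  also have "\<dots> = (\<integral>\<^sup>+y. indicator A y * emeasure lborel B \<partial>lborel)"
  proof (rule nn_integral_cong)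
    fix y
    obtain z where z: "y = T z" using surjT by auto
    have "(\<integral>\<^sup>+x. indicator B (y - T x) \<partial>lborel) = (\<integral>\<^sup>+x. indicator B (T x - T z) \<partial>lborel)"
      by (intro nn_integral_cong) (simp add: B_def indicator_def z norm_minus_commute)
    then show "(\<integral>\<^sup>+x. indicator A y * indicator B (y - T x) \<partial>lborel) = indicator A y * emeasure lborel B"
      by (simp add: nn_integral_cmult preserved)
  qed
  also have "\<dots> = emeasure lborel A * emeasure lborel B"
    by (simp add: nn_integral_multc)
  finally have "emeasure (distr lborel borel T) A * emeasure lborel B
      = emeasure lborel A * emeasure lborel B" .
  \<comment> \<open>The ball has positive finite measure, so its factor can be cancelled.\<close>
  moreover have "emeasure lborel B = ennreal (unit_ball_vol DIM('v))"
    by (simp add: B_def emeasure_ball)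
  moreover have "0 < unit_ball_vol DIM('v)" by simp
  ultimately show "emeasure (distr lborel borel T) A = emeasure lborel A"
    by (metis ennreal_mult_cancel_left mult.commute ennreal_eq_0_iff ennreal_neq_top not_less)
qed

section \<open>Radial densities on Euclidean space\<close>

lemma nn_integral_Gamma:
  assumes "0 < a"
  shows "(\<integral>\<^sup>+t. ennreal (t powr (a - 1) * exp (- t)) * indicator {0..} t \<partial>lborel) = ennreal (Gamma a)"
proof -
  have "((\<lambda>t. t powr (a - 1) * exp (- t)) has_integral Gamma a) {0..}"
    using Gamma_integral_real[OF assms] by (simp add: exp_minus divide_inverse)
  then show ?thesis
    by (rule nn_integral_has_integral_lebesgue'[rotated]) simp
qed

lemma nn_integral_lborel_scaleR:
  fixes g :: "'v::euclidean_space \<Rightarrow> ennreal"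
  assumes [measurable]: "g \<in> borel_measurable borel" and "0 < r"
  shows "(\<integral>\<^sup>+x. g x \<partial>lborel) = ennreal (r ^ DIM('v)) * (\<integral>\<^sup>+x. g (r *\<^sub>R x) \<partial>lborel)"
proof -
  have "(\<integral>\<^sup>+x. g x \<partial>lborel)
      = (\<integral>\<^sup>+x. g x \<partial>density (distr lborel borel (\<lambda>x. 0 + r *\<^sub>R x)) (\<lambda>_. \<bar>r\<bar> ^ DIM('v)))"
    using assms(2) by (subst lborel_affine[of r 0]) simp_all
  also have "\<dots> = ennreal (r ^ DIM('v)) * (\<integral>\<^sup>+x. g (r *\<^sub>R x) \<partial>lborel)"
    using assms(2) by (simp add: nn_integral_density nn_integral_distr nn_integral_cmult)
  finally show ?thesis .
qed

lemma nn_integral_lborel_plus: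
  fixes g :: "'v::euclidean_space \<Rightarrow> ennreal"
  assumes [measurable]: "g \<in> borel_measurable borel"
  shows "(\<integral>\<^sup>+x. g (c + x) \<partial>lborel) = (\<integral>\<^sup>+x. g x \<partial>lborel)"
proof -
  have "(\<integral>\<^sup>+x. g (c + x) \<partial>lborel) = (\<integral>\<^sup>+x. g x \<partial>distr lborel borel (\<lambda>x. c + x))"
    by (subst nn_integral_distr) auto
  also have "distr lborel borel (\<lambda>x. c + x) = lborel"
    by (rule lborel_distr_plus)
  finally show ?thesis .
qed

text \<open>Integrate \<open>h x (s - |x|\<^sup>2)\<^sup>b\<^sup>-\<^sup>1 exp (-s)\<close> over \<open>|x|\<^sup>2 < s\<close> in both orders: the \<open>s\<close>-integral gives
  \<open>Gamma b\<close> and the Gaussian weight, the \<open>x\<close>-integral scales like a power of \<open>s\<close>.\<close>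

lemma beta_gaussian_integral:
  fixes h :: "'v::euclidean_space \<Rightarrow> ennreal"
  assumes [measurable]: "h \<in> borel_measurable borel"
    and hom: "\<And>r x. 0 < r \<Longrightarrow> h (r *\<^sub>R x) = ennreal (r powr (2 * \<kappa>)) * h x"
    and b: "0 < b" "0 < DIM('v) / 2 + \<kappa> + b"
  shows "(\<integral>\<^sup>+x. h x * ennreal (if norm x < 1 then (1 - (norm x)\<^sup>2) powr (b - 1) else 0) \<partial>lborel)
      * ennreal (Gamma (DIM('v) / 2 + \<kappa> + b))
    = (\<integral>\<^sup>+x. h x * ennreal (exp (- (norm x)\<^sup>2)) \<partial>lborel) * ennreal (Gamma b)"
    (is "?I * _ = ?J * _")
proof -
  define F where "F x s = h x * ennreal (if (norm x)\<^sup>2 < s then (s - (norm x)\<^sup>2) powr (b - 1) * exp (- s) else 0)"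
    for x and s :: real
  have [measurable]: "(\<lambda>(x, s). F x s) \<in> borel_measurable (borel \<Otimes>\<^sub>M borel)"
    unfolding F_def by measurable
  have inner: "(\<integral>\<^sup>+s. F x s \<partial>lborel) = h x * ennreal (exp (- (norm x)\<^sup>2)) * ennreal (Gamma b)" for x
  proof -
    have "(\<integral>\<^sup>+s. F x s \<partial>lborel) = h x *
       (\<integral>\<^sup>+s. ennreal (if (norm x)\<^sup>2 < s then (s - (norm x)\<^sup>2) powr (b - 1) * exp (- s) else 0) \<partial>lborel)"
      unfolding F_def by (rule nn_integral_cmult) measurable
    also have "(\<integral>\<^sup>+s. ennreal (if (norm x)\<^sup>2 < s then (s - (norm x)\<^sup>2) powr (b - 1) * exp (- s) else 0) \<partial>lborel)
      = (\<integral>\<^sup>+s. ennreal (if (norm x)\<^sup>2 < (norm x)\<^sup>2 + s then ((norm x)\<^sup>2 + s - (norm x)\<^sup>2) powr (b - 1)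
            * exp (- ((norm x)\<^sup>2 + s)) else 0) \<partial>lborel)"
      by (rule nn_integral_lborel_plus[symmetric]) measurable
    \<comment> \<open>The strict inequality and the indicator of \<open>{0..}\<close> agree at
      \<open>s = 0\<close> too, because \<open>0 powr (b - 1) = 0\<close>.\<close>
    also have "\<dots> = (\<integral>\<^sup>+s. ennreal (exp (- (norm x)\<^sup>2)) *
        (ennreal (s powr (b - 1) * exp (- s)) * indicator {0..} s) \<partial>lborel)"
      by (intro nn_integral_cong)
        (auto simp: indicator_def exp_minus exp_diff ennreal_mult[symmetric] field_simps)
    also have "\<dots> = ennreal (exp (- (norm x)\<^sup>2)) * ennreal (Gamma b)"
      using b(1) by (subst nn_integral_cmult) (auto simp: nn_integral_Gamma)
    finally show ?thesis by (simp add: mult.assoc)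
  qed
  have outer: "(\<integral>\<^sup>+x. F x s \<partial>lborel)
      = ?I * (ennreal (s powr (DIM('v) / 2 + \<kappa> + b - 1) * exp (- s)) * indicator {0..} s)" for s
  proof (cases "0 < s")
    case True
    \<comment> \<open>Scaling by \<open>sqrt s\<close> carries the unit ball to the domain
      \<open>|x|^2 < s\<close>. The Jacobian, the homogeneity of \<open>h\<close> and the beta
      weight contribute \<open>DIM('v) / 2\<close>, \<open>\<kappa>\<close> and \<open>b - 1\<close>
      to the exponent of \<open>s\<close>.\<close>
    have "(\<integral>\<^sup>+x. F x s \<partial>lborel) = ennreal (sqrt s ^ DIM('v)) * (\<integral>\<^sup>+x. F (sqrt s *\<^sub>R x) s \<partial>lborel)"
      using True by (intro nn_integral_lborel_scaleR) (auto simp: F_def)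
    also have "(\<integral>\<^sup>+x. F (sqrt s *\<^sub>R x) s \<partial>lborel) = (\<integral>\<^sup>+x. ennreal (s powr \<kappa> * s powr (b - 1) * exp (- s)) *
        (h x * ennreal (if norm x < 1 then (1 - (norm x)\<^sup>2) powr (b - 1) else 0)) \<partial>lborel)"
    proof (rule nn_integral_cong)
      fix x :: 'v
      have 1: "(norm (sqrt s *\<^sub>R x))\<^sup>2 = s * (norm x)\<^sup>2"
        using True by (simp add: power_mult_distrib)
      have 2: "s * (norm x)\<^sup>2 < s \<longleftrightarrow> norm x < 1"
        using True by (simp add: power_less_one_iff abs_square_less_1)
      have 3: "(s - s * (norm x)\<^sup>2) powr (b - 1) = s powr (b - 1) * (1 - (norm x)\<^sup>2) powr (b - 1)" if "norm x < 1"
      proof -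
        have "0 \<le> 1 - (norm x)\<^sup>2" using that by (simp add: power_le_one)
        moreover have "s - s * (norm x)\<^sup>2 = s * (1 - (norm x)\<^sup>2)" by (simp add: algebra_simps)
        ultimately show ?thesis using True by (simp add: powr_mult)
      qed
      have 4: "h (sqrt s *\<^sub>R x) = ennreal (s powr \<kappa>) * h x"
        using True hom[of "sqrt s" x] by (simp add: powr_half_sqrt[symmetric] powr_powr)
      show "F (sqrt s *\<^sub>R x) s = ennreal (s powr \<kappa> * s powr (b - 1) * exp (- s)) *
        (h x * ennreal (if norm x < 1 then (1 - (norm x)\<^sup>2) powr (b - 1) else 0))"
        unfolding F_def 1 2 4 using 3 by (auto simp: ennreal_mult mult_ac)
    qed
    also have "\<dots> = ennreal (s powr \<kappa> * s powr (b - 1) * exp (- s)) * ?I"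
      by (rule nn_integral_cmult) measurable
    also have "ennreal (sqrt s ^ DIM('v)) * \<dots>
        = ?I * (ennreal (sqrt s ^ DIM('v)) * ennreal (s powr \<kappa> * s powr (b - 1) * exp (- s)))"
      by (simp add: mult_ac)
    also have "ennreal (sqrt s ^ DIM('v)) * ennreal (s powr \<kappa> * s powr (b - 1) * exp (- s))
        = ennreal (s powr (DIM('v) / 2 + \<kappa> + b - 1) * exp (- s))"
    proof -
      have "sqrt s ^ DIM('v) = s powr (DIM('v) / 2)"
        using True by (simp add: powr_half_sqrt[symmetric] powr_powr flip: powr_realpow)
      moreover have "s powr (DIM('v) / 2 + \<kappa> + b - 1) = s powr (DIM('v) / 2) * s powr \<kappa> * s powr (b - 1)"
        by (simp add: powr_add[symmetric] algebra_simps)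
      ultimately show ?thesis using True by (simp add: ennreal_mult[symmetric] mult_ac)
    qed
    finally show ?thesis using True by simp
  next
    case False
    then have "F x s = 0" for x
      unfolding F_def using zero_le_power2[of "norm x"] by (subst if_not_P) (linarith, simp)
    then show ?thesis using False by (auto simp: indicator_def)
  qed
  have "?I * ennreal (Gamma (DIM('v) / 2 + \<kappa> + b)) = (\<integral>\<^sup>+s. (\<integral>\<^sup>+x. F x s \<partial>lborel) \<partial>lborel)"
    unfolding outer using b(2) by (subst nn_integral_cmult) (auto simp: nn_integral_Gamma)
  also have "\<dots> = (\<integral>\<^sup>+x. (\<integral>\<^sup>+s. F x s \<partial>lborel) \<partial>lborel)"
    by (rule lborel_pair.Fubini') simp
  also have "\<dots> = ?J * ennreal (Gamma b)"
    unfolding inner by (subst nn_integral_multc) auto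
  finally show ?thesis .
qed

section \<open>Gaussian moments of a single entry\<close>

lemma nn_integral_lborel_scale_coordinate:
  fixes g :: "'a::euclidean_space ^ 'n \<Rightarrow> ennreal"
  assumes [measurable]: "g \<in> borel_measurable borel" and r: "0 < r"
  shows "(\<integral>\<^sup>+x. g x \<partial>lborel)
    = ennreal (r ^ DIM('a)) * (\<integral>\<^sup>+x. g (\<chi> j. if j = i then r *\<^sub>R x $ j else x $ j) \<partial>lborel)"
proof -
  define A :: "('a ^ 'n) set" where "A = axis i ` Basis"
  define c :: "'a ^ 'n \<Rightarrow> real" where "c b = (if b \<in> A then r else 1)" for b
  have A: "A \<subseteq> Basis" by (auto simp: A_def Basis_vec_def)
  \<comment> \<open>One entry occupies \<open>DIM('a)\<close> real coordinates, which is the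
    exponent of the Jacobian.\<close>
  have "card A = DIM('a)"
    unfolding A_def by (intro card_image inj_onI) (auto simp: axis_eq_axis)
  have c: "c (axis j u) = (if j = i then r else 1)" if "u \<in> Basis" for j and u :: 'a
    using that by (auto simp: c_def A_def axis_eq_axis)
  define T where "T x = 0 + (\<Sum>b\<in>Basis. (c b * (x \<bullet> b)) *\<^sub>R b)" for x
  have T: "T x = (\<chi> j. if j = i then r *\<^sub>R x $ j else x $ j)" for x
  proof (rule euclidean_eqI)
    fix b :: "'a ^ 'n" assume b: "b \<in> Basis"
    then obtain j u where bju: "b = axis j u" "u \<in> Basis" by (auto simp: Basis_vec_def)
    have "T x \<bullet> b = c b * (x \<bullet> b)"
      using b by (simp add: T_def)
    then show "T x \<bullet> b = (\<chi> j. if j = i then r *\<^sub>R x $ j else x $ j) \<bullet> b"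
      by (simp add: bju c inner_axis)
  qed
  have [measurable]: "T \<in> borel_measurable borel"
    unfolding T_def by measurable
  have "(\<Prod>b\<in>Basis. \<bar>c b\<bar>) = (\<Prod>b\<in>A. r)"
    using A r by (intro prod.mono_neutral_cong_right) (auto simp: c_def)
  also have "\<dots> = r ^ DIM('a)" by (simp add: \<open>card A = DIM('a)\<close>)
  finally have prod: "(\<Prod>b\<in>Basis. \<bar>c b\<bar>) = r ^ DIM('a)" .
  have leb: "lborel = density (distr lborel borel T) (\<lambda>_. ennreal (r ^ DIM('a)))"
    using lborel_affine_euclidean[of c 0] r unfolding prod T_def by (simp add: c_def)
  have "(\<integral>\<^sup>+x. g x \<partial>lborel)
      = (\<integral>\<^sup>+x. g x \<partial>density (distr lborel borel T) (\<lambda>_. ennreal (r ^ DIM('a))))"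
    by (subst leb) (rule refl)
  also have "\<dots> = ennreal (r ^ DIM('a)) * (\<integral>\<^sup>+x. g (T x) \<partial>lborel)"
    by (simp add: nn_integral_density nn_integral_distr nn_integral_cmult)
  finally show ?thesis by (simp add: T)
qed

lemma nn_integral_powr_tail:
  assumes "0 < p"
  shows "(\<integral>\<^sup>+t. ennreal (t powr (- p - 1)) * indicator {1..} t \<partial>lborel) = ennreal (1 / p)"
proof -
  have "(\<integral>\<^sup>+t. ennreal (t powr (- p - 1)) * indicator {1..} t \<partial>lborel)
      = ennreal (0 - (- (1 powr (- p) / p)))"
  proof (rule nn_integral_FTC_atLeast)
    show "DERIV (\<lambda>t. - (t powr (- p) / p)) t :> t powr (- p - 1)" if "1 \<le> t" for t
      using that assms by (auto intro!: derivative_eq_intros)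
    have "((\<lambda>t. - (t powr (- p) / p)) \<longlongrightarrow> - (0 / p)) at_top"
      using assms by (intro tendsto_intros tendsto_neg_powr filterlim_ident) auto
    then show "((\<lambda>t. - (t powr (- p) / p)) \<longlongrightarrow> 0) at_top" by simp
  qed auto
  then show ?thesis by simp
qed

lemma nn_integral_exp_tail:
  assumes "0 < u"
  shows "(\<integral>\<^sup>+t. ennreal (u * exp (- t * u)) * indicator {1..} t \<partial>lborel) = ennreal (exp (- u))"
proof -
  have "(\<integral>\<^sup>+t. ennreal (u * exp (- t * u)) * indicator {1..} t \<partial>lborel)
      = ennreal (0 - (- exp (- 1 * u)))"
  proof (rule nn_integral_FTC_atLeast)
    show "DERIV (\<lambda>t. - exp (- t * u)) t :> u * exp (- t * u)" for t
      by (auto intro!: derivative_eq_intros)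
    show "((\<lambda>t. - exp (- t * u)) \<longlongrightarrow> 0) at_top"
      using assms by real_asymp
  qed (use assms in auto)
  then show ?thesis by simp
qed

lemma borel_measurable_vec_nth [measurable (raw)]:
  fixes f :: "'w \<Rightarrow> 'a::euclidean_space ^ 'n"
  assumes "f \<in> borel_measurable M"
  shows "(\<lambda>x. f x $ i) \<in> borel_measurable M"
proof -
  have "(\<lambda>x :: 'a ^ 'n. x $ i) \<in> borel_measurable borel"
    by (intro borel_measurable_continuous_onI continuous_intros)
  from measurable_compose[OF assms this] show ?thesis .
qed

text \<open>The \<open>itself\<close> argument fixes the entry type, which the other arguments do
  not determine. Values in \<open>ennreal\<close> let the recursion be proved without a prior
  finiteness argument, and the Gaussian weight stays unnormalised since only ratios of moments
  matter.\<close>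

definition gauss_moment :: "'n::finite \<Rightarrow> 'a::euclidean_space itself \<Rightarrow> real \<Rightarrow> ennreal"
  where "gauss_moment i _ \<kappa> =
    (\<integral>\<^sup>+x. ennreal ((norm (x $ i))\<^sup>2 powr \<kappa>) * ennreal (exp (- (norm x)\<^sup>2)) \<partial>(lborel :: ('a::euclidean_space ^ 'n) measure))"

text \<open>Write \<open>exp (-u) = \<integral>\<^sub>1 u exp (-t u) dt\<close> with \<open>u = |x\<^sub>i|\<^sup>2\<close> and rescale the coordinate \<open>x\<^sub>i\<close> by \<open>t\<^sup>-\<^sup>1\<^sup>/\<^sup>2\<close>.\<close>

lemma gauss_moment_rec:
  fixes i :: "'n::finite"
  assumes "0 < DIM('a) / 2 + \<kappa>"
  shows "gauss_moment i TYPE('a::euclidean_space) \<kappa>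
    = gauss_moment i TYPE('a) (\<kappa> + 1) * ennreal (1 / (DIM('a) / 2 + \<kappa>))"
proof -
  define u where "u x = (norm (x $ i))\<^sup>2" for x :: "'a ^ 'n"
  have [measurable]: "u \<in> borel_measurable borel" unfolding u_def by measurable
  \<comment> \<open>The factor \<open>u\<close> in the integral representation of
    \<open>exp (-u)\<close> raises the exponent to \<open>\<kappa> + 1\<close>; the other entries
    keep their Gaussian weight.\<close>
  define F where "F x t = ennreal (u x powr (\<kappa> + 1) * exp (- t * u x) * exp (- ((norm x)\<^sup>2 - u x))) * indicator {1..} t"
    for x and t :: real
  have [measurable]: "(\<lambda>(x, t). F x t) \<in> borel_measurable (borel \<Otimes>\<^sub>M borel)"
    unfolding F_def by measurable
  have inner: "(\<integral>\<^sup>+t. F x t \<partial>lborel) = ennreal (u x powr \<kappa>) * ennreal (exp (- (norm x)\<^sup>2))" for x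
  \<comment> \<open>For \<open>u x = 0\<close> both sides vanish, because \<open>0 powr\<close> any
    exponent is 0, also for \<open>\<kappa> = 0\<close>.\<close>
  proof (cases "u x = 0")
    case False
    then have u: "0 < u x" by (simp add: u_def)
    have "(\<integral>\<^sup>+t. F x t \<partial>lborel) = (\<integral>\<^sup>+t. ennreal (u x powr \<kappa> * exp (- ((norm x)\<^sup>2 - u x))) *
       (ennreal (u x * exp (- t * u x)) * indicator {1..} t) \<partial>lborel)"
      unfolding F_def using u
      by (intro nn_integral_cong) (simp add: ennreal_mult powr_add mult_ac)
    also have "\<dots> = ennreal (u x powr \<kappa> * exp (- ((norm x)\<^sup>2 - u x))) * ennreal (exp (- u x))"
      by (subst nn_integral_cmult) (measurable, simp only: nn_integral_exp_tail[OF u])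
    also have "\<dots> = ennreal (u x powr \<kappa>) * ennreal (exp (- (norm x)\<^sup>2))"
      by (simp add: ennreal_mult[symmetric] mult.assoc exp_add[symmetric])
    finally show ?thesis .
  qed (simp add: F_def)
  have outer: "(\<integral>\<^sup>+x. F x t \<partial>lborel)
    = gauss_moment i TYPE('a) (\<kappa> + 1) * (ennreal (t powr (- (DIM('a) / 2 + \<kappa>) - 1)) * indicator {1..} t)" for t
  proof (cases "1 \<le> t")
    case True
    \<comment> \<open>Chosen so that \<open>t * r^2 = 1\<close>: rescaling then turns
      \<open>exp (-t u)\<close> into \<open>exp (-u)\<close> and restores the full Gaussian
      weight.\<close>
    define r where "r = t powr (- 1 / 2)"
    have r: "0 < r" "r\<^sup>2 = 1 / t"
    proof -
      have "r\<^sup>2 = t powr (- 1)" using True by (simp add: r_def powr_power)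
      then show "0 < r" "r\<^sup>2 = 1 / t" using True by (simp_all add: r_def powr_minus_divide)
    qed
    define S where "S x = (\<chi> j. if j = i then r *\<^sub>R x $ j else x $ j)" for x :: "'a ^ 'n"
    have uS: "u (S x) = r\<^sup>2 * u x" for x
      using r by (simp add: u_def S_def power_mult_distrib)
    have nS: "(norm (S x))\<^sup>2 - u (S x) = (norm x)\<^sup>2 - u x" for x
    proof -
      have "(norm z)\<^sup>2 - u z = (\<Sum>j\<in>UNIV - {i}. (norm (z $ j))\<^sup>2)" for z :: "'a ^ 'n"
        by (simp add: u_def power2_norm_vec sum_diff1)
      then show ?thesis by (simp add: S_def)
    qed
    have "(\<integral>\<^sup>+x. F x t \<partial>lborel) = ennreal (r ^ DIM('a)) * (\<integral>\<^sup>+x. F (S x) t \<partial>lborel)"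
      unfolding S_def using r by (intro nn_integral_lborel_scale_coordinate) (auto simp: F_def)
    also have "(\<integral>\<^sup>+x. F (S x) t \<partial>lborel) = (\<integral>\<^sup>+x. ennreal ((r\<^sup>2) powr (\<kappa> + 1)) *
       (ennreal (u x powr (\<kappa> + 1)) * ennreal (exp (- (norm x)\<^sup>2))) \<partial>lborel)"
    proof (rule nn_integral_cong)
      fix x
      have "exp (- t * (r\<^sup>2 * u x)) * exp (- ((norm x)\<^sup>2 - u x)) = exp (- (norm x)\<^sup>2)"
        using True by (simp add: r(2) exp_add[symmetric])
      moreover have "(r\<^sup>2 * u x) powr (\<kappa> + 1) = (r\<^sup>2) powr (\<kappa> + 1) * u x powr (\<kappa> + 1)"
        by (rule powr_mult)
      ultimately show "F (S x) t = ennreal ((r\<^sup>2) powr (\<kappa> + 1)) *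
          (ennreal (u x powr (\<kappa> + 1)) * ennreal (exp (- (norm x)\<^sup>2)))"
        using True unfolding F_def nS unfolding uS by (simp add: ennreal_mult[symmetric] mult.assoc)
    qed
    also have "\<dots> = ennreal ((r\<^sup>2) powr (\<kappa> + 1)) * gauss_moment i TYPE('a) (\<kappa> + 1)"
      unfolding gauss_moment_def u_def by (rule nn_integral_cmult) measurable
    also have "ennreal (r ^ DIM('a)) * \<dots>
        = gauss_moment i TYPE('a) (\<kappa> + 1) * (ennreal (r ^ DIM('a)) * ennreal ((r\<^sup>2) powr (\<kappa> + 1)))"
      by (simp add: mult_ac)
    also have "ennreal (r ^ DIM('a)) * ennreal ((r\<^sup>2) powr (\<kappa> + 1)) = ennreal (t powr (- (DIM('a) / 2 + \<kappa>) - 1))"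
    proof -
      have "(r\<^sup>2) powr (\<kappa> + 1) = t powr (- (\<kappa> + 1))"
      proof -
        have "1 / t = t powr (- 1)" using True by (simp add: powr_minus_divide)
        then show ?thesis unfolding r(2) by (simp only: powr_powr) simp
      qed
      moreover have "r ^ DIM('a) = t powr (- (DIM('a) / 2))"
        using True by (simp add: r_def powr_power)
      ultimately have "r ^ DIM('a) * (r\<^sup>2) powr (\<kappa> + 1) = t powr (- (DIM('a) / 2) + - (\<kappa> + 1))"
        by (simp only: powr_add)
      also have "- (DIM('a) / 2) + - (\<kappa> + 1) = - (DIM('a) / 2 + \<kappa>) - 1" by simp
      finally show ?thesis using r(1) by (simp add: ennreal_mult[symmetric])
    qed
    finally show ?thesis using True by simp
  qed (simp add: F_def)
  have "gauss_moment i TYPE('a) \<kappa> = (\<integral>\<^sup>+x. (\<integral>\<^sup>+t. F x t \<partial>lborel) \<partial>lborel)"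
    unfolding inner by (simp add: gauss_moment_def u_def)
  also have "\<dots> = (\<integral>\<^sup>+t. (\<integral>\<^sup>+x. F x t \<partial>lborel) \<partial>lborel)"
    by (rule lborel_pair.Fubini') simp
  also have "\<dots> = gauss_moment i TYPE('a) (\<kappa> + 1) * ennreal (1 / (DIM('a) / 2 + \<kappa>))"
    unfolding outer using assms nn_integral_powr_tail[OF assms] by (subst nn_integral_cmult) auto
  finally show ?thesis .
qed

section \<open>Moments of beta type I rows\<close>

definition beta_I_measure ::
    "real \<Rightarrow> real \<Rightarrow> ('a::{real_normed_div_algebra, euclidean_space} ^ 'n) measure"
  where "beta_I_measure \<beta> \<nu> = density lborel (\<lambda>x. ennreal (beta_I_density \<beta> \<nu> x))"

lemma beta_I_density_eq:
  fixes x :: "'a::{real_normed_div_algebra, euclidean_space} ^ 'n"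
  shows "beta_I_density \<beta> \<nu> x =
    pi powr (- (\<beta> * real CARD('n) / 2)) * gamma_ratio (\<beta> * \<nu> / 2) (\<beta> * real CARD('n) / 2) *
      (if norm x < 1 then (1 - (norm x)\<^sup>2) powr (\<beta> * \<nu> / 2 - 1) else 0)"
  by (simp add: beta_I_density_def)

lemma borel_measurable_beta_I_density [measurable]:
  "beta_I_density \<beta> \<nu> \<in> borel_measurable (borel :: ('a::{real_normed_div_algebra, euclidean_space} ^ 'n) measure)"
  unfolding beta_I_density_def[abs_def] by measurable

lemma space_beta_I_measure [simp]: "space (beta_I_measure \<beta> \<nu>) = UNIV"
  and sets_beta_I_measure [simp, measurable_cong]: "sets (beta_I_measure \<beta> \<nu>) = sets borel"
  by (simp_all add: beta_I_measure_def)

lemma nn_integral_beta_I_measure: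
  fixes g :: "'a::{real_normed_div_algebra, euclidean_space} ^ 'n \<Rightarrow> ennreal"
  assumes [measurable]: "g \<in> borel_measurable borel"
  shows "(\<integral>\<^sup>+x. g x \<partial>beta_I_measure \<beta> \<nu>) = (\<integral>\<^sup>+x. ennreal (beta_I_density \<beta> \<nu> x) * g x \<partial>lborel)"
  unfolding beta_I_measure_def by (subst nn_integral_density) auto

text \<open>If \<open>x $ i = 0\<close>, then \<open>x\<close> lies in a coordinate hyperplane,
  which is a null set; the upper bound holds because the density lives on the unit ball. Strict
  positivity is what later admits logarithms and negative powers.\<close>

lemma AE_beta_I_measure:
  fixes i :: "'n::finite"
  shows "AE x in (beta_I_measure \<beta> \<nu> :: ('a::{real_normed_div_algebra, euclidean_space} ^ 'n) measure).
    0 < (norm (x $ i))\<^sup>2 \<and> (norm (x $ i))\<^sup>2 \<le> 1"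
proof -
  obtain u :: 'a where u: "u \<in> Basis" using nonempty_Basis by blast
  then have "axis i u \<in> (Basis :: ('a ^ 'n) set)" by (auto simp: Basis_vec_def)
  then have "{x :: 'a ^ 'n. x \<bullet> axis i u = 0} \<in> null_sets lebesgue"
    using negligible_standard_hyperplane[of "axis i u" 0] by (simp add: negligible_iff_null_sets)
  moreover have "{x :: 'a ^ 'n. x \<bullet> axis i u = 0} \<in> sets borel" by measurable
  ultimately have "{x :: 'a ^ 'n. x \<bullet> axis i u = 0} \<in> null_sets lborel"
    by (auto simp: null_sets_def)
  then have "AE x :: 'a ^ 'n in lborel. x \<notin> {x. x \<bullet> axis i u = 0}" by (rule AE_not_in)
  then have "AE x :: 'a ^ 'n in lborel. 0 < ennreal (beta_I_density \<beta> \<nu> x) \<longrightarrow>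
      0 < (norm (x $ i))\<^sup>2 \<and> (norm (x $ i))\<^sup>2 \<le> 1"
  proof (rule AE_mp, intro AE_I2 impI)
    fix x :: "'a ^ 'n"
    assume x: "x \<notin> {x. x \<bullet> axis i u = 0}" and d: "0 < ennreal (beta_I_density \<beta> \<nu> x)"
    have "x $ i \<noteq> 0" using x by (auto simp: inner_axis)
    moreover have "norm x < 1" using d by (auto simp: beta_I_density_def split: if_splits)
    then have "norm (x $ i) \<le> 1" using Finite_Cartesian_Product.norm_nth_le[of x i] by linarith
    ultimately show "0 < (norm (x $ i))\<^sup>2 \<and> (norm (x $ i))\<^sup>2 \<le> 1"
      by (simp add: power_le_one)
  qed
  then show ?thesis
    unfolding beta_I_measure_def by (subst AE_density) auto
qed

lemma gamma_ratio_nonneg: "0 < c \<Longrightarrow> 0 \<le> s \<Longrightarrow> 0 \<le> gamma_ratio c s"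
  unfolding gamma_ratio_def by (intro divide_nonneg_nonneg order_less_imp_le Gamma_real_pos) auto

lemma DIM_vec_ge: "real DIM('a::euclidean_space) \<le> real DIM('a ^ 'n)"
  by (simp add: Suc_le_eq card_gt_0_iff)

text \<open>The integrand is homogeneous of degree \<open>2 * \<kappa>\<close>, so the comparison of
  beta and Gaussian weights applies. The Gamma factor stays on the left, which avoids a division in
  \<open>ennreal\<close>.\<close>

lemma beta_I_powr_moment:
  fixes i :: "'n::finite" and \<nu> \<kappa> :: real
  assumes \<nu>: "0 < \<nu>" and \<kappa>: "0 < DIM('a) / 2 + \<kappa>"
  shows "(\<integral>\<^sup>+x. ennreal ((norm (x $ i))\<^sup>2 powr \<kappa>)
      \<partial>(beta_I_measure DIM('a) \<nu> :: ('a::{real_normed_div_algebra, euclidean_space} ^ 'n) measure))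
        * ennreal (Gamma (DIM('a ^ 'n) / 2 + \<kappa> + DIM('a) * \<nu> / 2))
    = ennreal (pi powr (- (DIM('a) * real CARD('n) / 2)) * gamma_ratio (DIM('a) * \<nu> / 2) (DIM('a) * real CARD('n) / 2))
      * (gauss_moment i TYPE('a) \<kappa> * ennreal (Gamma (DIM('a) * \<nu> / 2)))"
    (is "?m * ?G = ennreal ?C * ?r")
proof -
  have C: "0 \<le> ?C"
    using \<nu> by (intro mult_nonneg_nonneg gamma_ratio_nonneg) auto
  let ?h = "\<lambda>x :: 'a ^ 'n. ennreal ((norm (x $ i))\<^sup>2 powr \<kappa>)"
  let ?b = "DIM('a) * \<nu> / 2"
  have dens: "ennreal (beta_I_density DIM('a) \<nu> x)
      = ennreal ?C * ennreal (if norm x < 1 then (1 - (norm x)\<^sup>2) powr (?b - 1) else 0)" for x :: "'a ^ 'n"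
    unfolding beta_I_density_eq using C by (rule ennreal_mult')
  have "?m = (\<integral>\<^sup>+x. ennreal (beta_I_density DIM('a) \<nu> x) * ?h x \<partial>lborel)"
    by (rule nn_integral_beta_I_measure) measurable
  also have "\<dots> = (\<integral>\<^sup>+x. ennreal ?C * (?h x * ennreal (if norm x < 1 then (1 - (norm x)\<^sup>2) powr (?b - 1) else 0)) \<partial>lborel)"
    unfolding dens by (intro nn_integral_cong) (simp only: mult.assoc mult.left_commute mult.commute)
  also have "\<dots> = ennreal ?C * (\<integral>\<^sup>+x. ?h x * ennreal (if norm x < 1 then (1 - (norm x)\<^sup>2) powr (?b - 1) else 0) \<partial>lborel)"
    by (rule nn_integral_cmult) measurable
  finally have m: "?m = ennreal ?C * (\<integral>\<^sup>+x. ?h x * ennreal (if norm x < 1 then (1 - (norm x)\<^sup>2) powr (?b - 1) else 0) \<partial>lborel)" .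
  have "(\<integral>\<^sup>+x. ?h x * ennreal (if norm x < 1 then (1 - (norm x)\<^sup>2) powr (?b - 1) else 0) \<partial>lborel) * ?G = ?r"
    unfolding gauss_moment_def
  proof (rule beta_gaussian_integral[where h = "?h"])
    show "?h (r *\<^sub>R x) = ennreal (r powr (2 * \<kappa>)) * ?h x" if "0 < r" for r x
    proof -
      have "r\<^sup>2 = r powr 2" using that by simp
      then have "(r\<^sup>2) powr \<kappa> = r powr (2 * \<kappa>)" by (simp only: powr_powr)
      then show ?thesis by (simp add: power_mult_distrib powr_mult ennreal_mult)
    qed
    show "0 < ?b" using \<nu> by simp
    then show "0 < DIM('a ^ 'n) / 2 + \<kappa> + ?b" using \<kappa> DIM_vec_ge[where 'a='a and 'n='n] by linarith
    show "?h \<in> borel_measurable borel" by measurable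
  qed
  then show ?thesis unfolding m by (simp only: mult.assoc)
qed

text \<open>Both moments are the same constant \<open>K\<close> times a Gaussian moment, up to Gamma
  factors. The Gaussian recursion links the two, and \<open>Gamma (c + 1) = c * Gamma c\<close>
  leaves a rational ratio. It is stated for real \<open>\<kappa>\<close> because it is also needed
  at a negative exponent.\<close>

lemma beta_I_powr_moment_rec:
  fixes i :: "'n::finite" and \<nu> \<kappa> :: real
  defines "m \<equiv> \<lambda>\<kappa> \<nu>. \<integral>\<^sup>+x. ennreal ((norm (x $ i))\<^sup>2 powr \<kappa>)
      \<partial>(beta_I_measure DIM('a) \<nu> :: ('a::{real_normed_div_algebra, euclidean_space} ^ 'n) measure)"
  assumes \<nu>: "0 < \<nu>" and \<kappa>: "0 < DIM('a) / 2 + \<kappa>"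
  shows "m \<kappa> \<nu> * ennreal ((DIM('a) / 2 + \<kappa>) / (DIM('a) * (real CARD('n) + \<nu>) / 2 + \<kappa>)) = m (\<kappa> + 1) \<nu>"
proof -
  let ?a = "DIM('a) / 2 + \<kappa>" and ?c = "DIM('a) * (real CARD('n) + \<nu>) / 2 + \<kappa>"
  have c: "?c = DIM('a ^ 'n) / 2 + \<kappa> + DIM('a) * \<nu> / 2" "?c + 1 = DIM('a ^ 'n) / 2 + (\<kappa> + 1) + DIM('a) * \<nu> / 2"
    by (simp_all add: distrib_left add_divide_distrib)
  have c0: "0 < ?c"
  proof -
    have "0 < DIM('a) * \<nu> / 2" using \<nu> by simp
    then show ?thesis
      using \<kappa> DIM_vec_ge[where 'a='a and 'n='n] unfolding c(1) by linarith
  qed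
  have cancel: "ennreal (c * g) * ennreal (1 / a) * (ennreal a * ennreal (1 / (c * g))) = 1"
      "ennreal g * (ennreal a * ennreal (1 / (c * g))) = ennreal (a / c)"
    if "0 < c" "0 < g" "0 < a" for a c g :: real
    using that by (simp_all add: ennreal_mult[symmetric])
  have assoc: "x * (g * w) = y * (h * a * w)" if "x * g = y * h * a" for x g w y h a :: ennreal
    using that by (simp add: mult.assoc[symmetric])
  have G: "Gamma (?c + 1) = ?c * Gamma ?c" using c0 by (intro Gamma_plus1) (meson nonpos_Ints_nonpos not_less)
  have Gpos: "0 < Gamma ?c" using c0 by (rule Gamma_real_pos)
  define C where "C = ennreal (pi powr (- (DIM('a) * real CARD('n) / 2)) * gamma_ratio (DIM('a) * \<nu> / 2) (DIM('a) * real CARD('n) / 2))"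
  define K where "K = C * ennreal (Gamma (DIM('a) * \<nu> / 2))"
  have K: "m \<kappa> \<nu> * ennreal (Gamma (DIM('a ^ 'n) / 2 + \<kappa> + DIM('a) * \<nu> / 2))
      = K * gauss_moment i TYPE('a) \<kappa>" if "0 < DIM('a) / 2 + \<kappa>" for \<kappa>
    unfolding m_def beta_I_powr_moment[OF \<nu> that, of i] K_def C_def by (simp only: mult_ac)
  have "m \<kappa> \<nu> * ennreal (Gamma ?c) = K * gauss_moment i TYPE('a) \<kappa>"
    unfolding c(1) by (rule K[OF \<kappa>])
  also have "\<dots> = K * gauss_moment i TYPE('a) (\<kappa> + 1) * ennreal (1 / ?a)"
    unfolding gauss_moment_rec[OF \<kappa>, of i] by (simp add: mult.assoc)
  also have "K * gauss_moment i TYPE('a) (\<kappa> + 1) = m (\<kappa> + 1) \<nu> * ennreal (Gamma (?c + 1))"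
    unfolding c(2) using \<kappa> by (intro K[symmetric]) simp
  finally have "m \<kappa> \<nu> * ennreal (Gamma ?c) = m (\<kappa> + 1) \<nu> * ennreal (Gamma (?c + 1)) * ennreal (1 / ?a)" .
  \<comment> \<open>Multiplication by the finite positive number \<open>a / (c * Gamma c)\<close>
    replaces cancellation in \<open>ennreal\<close>.\<close>
  then have "m \<kappa> \<nu> * (ennreal (Gamma ?c) * (ennreal ?a * ennreal (1 / (?c * Gamma ?c))))
      = m (\<kappa> + 1) \<nu> * (ennreal (Gamma (?c + 1)) * ennreal (1 / ?a) * (ennreal ?a * ennreal (1 / (?c * Gamma ?c))))"
    by (rule assoc)
  then show ?thesis
    unfolding G cancel[OF c0 Gpos \<kappa>] by (simp only: mult_1_right)
qed

context
  fixes \<nu> :: real and i :: "'n::finite" and R :: "('a::{real_normed_div_algebra, euclidean_space} ^ 'n) measure"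
  assumes \<nu>: "0 < \<nu>" and R_def: "R = beta_I_measure DIM('a) \<nu>" and prob: "prob_space R"
begin

interpretation prob_space R by (rule prob)

lemma sets_eq_borel [measurable_cong]: "sets R = sets borel"
  by (simp add: R_def)

lemma AE_coordinate_sq: "AE x in R. 0 < (norm (x $ i))\<^sup>2 \<and> (norm (x $ i))\<^sup>2 \<le> 1"
  unfolding R_def by (rule AE_beta_I_measure)

lemma integrable_coordinate_power: "integrable R (\<lambda>x. ((norm (x $ i))\<^sup>2) ^ k)"
proof (rule integrable_const_bound[where B = 1])
  show "AE x in R. norm (((norm (x $ i))\<^sup>2) ^ k) \<le> 1"
    by (rule AE_mp[OF AE_coordinate_sq], intro AE_I2 impI) (simp add: power_le_one)
qed measurable

text \<open>The recursion, started from total mass one at \<open>k = 0\<close>, builds up both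
  Pochhammer symbols factor by factor.\<close>

lemma beta_I_coordinate_power_moment:
  "(\<integral>x. ((norm (x $ i))\<^sup>2) ^ k \<partial>R)
    = pochhammer (DIM('a) / 2) k / pochhammer (DIM('a) * (real CARD('n) + \<nu>) / 2) k"
proof -
  have "(\<integral>\<^sup>+x. ennreal ((norm (x $ i))\<^sup>2 powr k) \<partial>R)
      = ennreal (pochhammer (DIM('a) / 2) k / pochhammer (DIM('a) * (real CARD('n) + \<nu>) / 2) k)"
  proof (induction k)
    case 0
    \<comment> \<open>The integrand is 1 only almost everywhere, since
      \<open>0 powr 0 = 0\<close>.\<close>
    have "(\<integral>\<^sup>+x. ennreal ((norm (x $ i))\<^sup>2 powr 0) \<partial>R) = (\<integral>\<^sup>+x. 1 \<partial>R)"
      by (rule nn_integral_cong_AE, rule AE_mp[OF AE_coordinate_sq], intro AE_I2 impI) simp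
    then show ?case by (simp add: emeasure_space_1)
  next
    case (Suc k)
    have "(\<integral>\<^sup>+x. ennreal ((norm (x $ i))\<^sup>2 powr Suc k) \<partial>R)
      = (\<integral>\<^sup>+x. ennreal ((norm (x $ i))\<^sup>2 powr k) \<partial>R) *
        ennreal ((DIM('a) / 2 + k) / (DIM('a) * (real CARD('n) + \<nu>) / 2 + k))"
      using beta_I_powr_moment_rec[OF \<nu>, where 'a='a and \<kappa>=k and i=i, OF add_pos_nonneg]
      by (simp add: R_def add.commute)
    then show ?case
      unfolding Suc.IH using \<nu>
      by (simp add: ennreal_mult[symmetric] pochhammer_Suc pochhammer_nonneg)
  qed
  moreover have "(\<integral>\<^sup>+x. ennreal ((norm (x $ i))\<^sup>2 powr k) \<partial>R) = (\<integral>\<^sup>+x. ennreal (((norm (x $ i))\<^sup>2) ^ k) \<partial>R)"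
    by (rule nn_integral_cong_AE, rule AE_mp[OF AE_coordinate_sq], intro AE_I2 impI) (simp add: powr_realpow)
  moreover have "0 \<le> pochhammer (DIM('a) / 2) k / pochhammer (DIM('a) * (real CARD('n) + \<nu>) / 2) k"
    using \<nu> by (intro divide_nonneg_nonneg pochhammer_nonneg) auto
  ultimately show ?thesis
    by (intro integral_eq_nn_integral[THEN trans]) auto
qed

text \<open>Expanding the exponential and integrating termwise turns the moments into the
  hypergeometric series. The exchange is justified by \<open>t ^ k / fact k\<close>, which dominates
  the terms since the entry has norm at most 1.\<close>

lemma beta_I_coordinate_laplace:
  assumes "0 \<le> t"
  shows "(\<integral>x. exp (- t * (norm (x $ i))\<^sup>2) \<partial>R)
    = hyp_1F1 (DIM('a) / 2) (DIM('a) * (real CARD('n) + \<nu>) / 2) (- t)"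
proof -
  define f where "f k x = (- t) ^ k / fact k * ((norm (x $ i))\<^sup>2) ^ k" for k and x :: "'a ^ 'n"
  have expf: "exp (- t * (norm (x $ i))\<^sup>2) = (\<Sum>k. f k x)" for x
  proof -
    have "f k x = (- t * (norm (x $ i))\<^sup>2) ^ k /\<^sub>R fact k" for k
      by (simp add: f_def power_mult_distrib[symmetric] divide_inverse)
    then show ?thesis by (simp add: exp_def)
  qed
  have f_int: "integrable R (f k)" for k
    unfolding f_def by (intro integrable_mult_right integrable_coordinate_power)
  have summ: "summable (\<lambda>k. norm (f k x))" for x
    using summable_norm_exp[of "- t * (norm (x $ i))\<^sup>2"]
    by (simp add: f_def power_mult_distrib abs_mult field_simps power_abs norm_power)
  have "(\<integral>x. norm (f k x) \<partial>R) \<le> t ^ k / fact k" for k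
  proof -
    have "(\<integral>x. norm (f k x) \<partial>R) \<le> (\<integral>x. t ^ k / fact k \<partial>R)"
    proof (rule integral_mono_AE)
      show "AE x in R. norm (f k x) \<le> t ^ k / fact k"
        using AE_coordinate_sq
      proof (rule AE_mp, intro AE_I2 impI)
        fix x :: "'a ^ 'n" assume "0 < (norm (x $ i))\<^sup>2 \<and> (norm (x $ i))\<^sup>2 \<le> 1"
        then have "((norm (x $ i))\<^sup>2) ^ k \<le> 1" by (meson power_le_one less_imp_le)
        then have "t ^ k / fact k * ((norm (x $ i))\<^sup>2) ^ k \<le> t ^ k / fact k * 1"
          using assms by (intro mult_left_mono) auto
        then show "norm (f k x) \<le> t ^ k / fact k"
          using assms by (simp add: f_def abs_mult power_abs)
      qed
    qed (use f_int in auto)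
    then show ?thesis by (simp add: prob_space)
  qed
  then have bound: "norm (\<integral>x. norm (f k x) \<partial>R) \<le> t ^ k / fact k" for k
    by (simp add: integral_nonneg_AE)
  have "summable (\<lambda>k. t ^ k / fact k)"
    using summable_exp_generic[of t] by (simp add: divide_inverse_commute)
  then have "summable (\<lambda>k. \<integral>x. norm (f k x) \<partial>R)"
    by (rule summable_comparison_test'[where N = 0]) (rule bound)
  then have "(\<integral>x. (\<Sum>k. f k x) \<partial>R) = (\<Sum>k. \<integral>x. f k x \<partial>R)"
    by (intro integral_suminf f_int AE_I2 summ)
  also have "\<dots> = hyp_1F1 (DIM('a) / 2) (DIM('a) * (real CARD('n) + \<nu>) / 2) (- t)"
    unfolding hyp_1F1_def f_def by (simp add: beta_I_coordinate_power_moment mult.commute)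
  finally show ?thesis unfolding expf .
qed

text \<open>The recursion for the moments at exponent \<open>-1/4\<close>, which exceeds \<open>-\<beta>/2\<close>, reduces to the exponent \<open>3/4\<close>.\<close>

lemma beta_I_coordinate_negative_moment:
  "(\<integral>\<^sup>+x. ennreal ((norm (x $ i))\<^sup>2 powr (- 1 / 4)) \<partial>R) < top"
proof -
  have d: "1 \<le> real DIM('a)" by (simp add: Suc_le_eq)
  let ?c = "(DIM('a) / 2 - 1 / 4) / (DIM('a) * (real CARD('n) + \<nu>) / 2 - 1 / 4)"
  have "1 \<le> DIM('a) * (real CARD('n) + \<nu>)"
  proof -
    have "1 \<le> real CARD('n)" by (simp add: Suc_le_eq card_gt_0_iff)
    then have "1 * 1 \<le> DIM('a) * (real CARD('n) + \<nu>)"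
      using d \<nu> by (intro mult_mono) linarith+
    then show ?thesis by simp
  qed
  \<comment> \<open>Numerator and denominator are both at least \<open>1/2 - 1/4\<close>.\<close>
  then have c: "0 < ?c" using d by (intro divide_pos_pos) linarith+
  have "(\<integral>\<^sup>+x. ennreal ((norm (x $ i))\<^sup>2 powr (- 1 / 4)) \<partial>R) * ennreal ?c
      = (\<integral>\<^sup>+x. ennreal ((norm (x $ i))\<^sup>2 powr (3 / 4)) \<partial>R)"
    using beta_I_powr_moment_rec[OF \<nu>, where 'a='a and \<kappa>="-1/4" and i=i] d by (simp add: R_def)
  also have "\<dots> \<le> (\<integral>\<^sup>+x. 1 \<partial>R)"
    by (rule nn_integral_mono_AE, rule AE_mp[OF AE_coordinate_sq], intro AE_I2 impI) (simp add: powr_le1 abs_square_le_1)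
  also have "\<dots> < top" by (simp add: emeasure_space_1)
  finally have fin: "(\<integral>\<^sup>+x. ennreal ((norm (x $ i))\<^sup>2 powr (- 1 / 4)) \<partial>R) * ennreal ?c < top" .
  have "z < top" if "z * ennreal c < top" "0 < c" for z and c :: real
    using that by (cases "z = top") (auto simp: ennreal_top_mult less_top)
  from this[OF fin c] show ?thesis .
qed

text \<open>The orthogonal map carrying multiplication by \<open>y\<close> to entry \<open>i\<close>
  preserves Lebesgue measure, and it preserves the density, which depends on \<open>norm x\<close>
  only.\<close>

lemma beta_I_row_mult_distr:
  assumes "norm y = 1"
  shows "distr R borel (\<lambda>x. (norm (row_mult x y))\<^sup>2) = distr R borel (\<lambda>x. (norm (x $ i))\<^sup>2)"
proof -
  obtain T :: "'a ^ 'n \<Rightarrow> 'a ^ 'n"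
    where T: "orthogonal_transformation T" "\<And>x. T x $ i = row_mult x y"
    using row_mult_orthogonal[OF assms] by blast
  have [measurable]: "T \<in> borel_measurable borel"
    using orthogonal_transformation_linear[OF T(1)]
    by (simp add: borel_measurable_continuous_onI linear_continuous_on linear_conv_bounded_linear)
  have "beta_I_density \<beta> \<nu> (T x) = beta_I_density \<beta> \<nu> x" for \<beta> \<nu> x
    using T(1) by (simp add: beta_I_density_def orthogonal_transformation)
  then have "distr R borel T = density (distr lborel borel T) (\<lambda>x. ennreal (beta_I_density DIM('a) \<nu> x))"
    unfolding R_def beta_I_measure_def by (subst density_distr) auto
  also have "\<dots> = R"
    by (simp add: R_def beta_I_measure_def lborel_distr_orthogonal[OF T(1)])
  finally have "distr R borel (\<lambda>x. (norm (x $ i))\<^sup>2) = distr (distr R borel T) borel (\<lambda>x. (norm (x $ i))\<^sup>2)"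
    by simp
  also have "\<dots> = distr R borel (\<lambda>x. (norm (row_mult x y))\<^sup>2)"
    by (subst distr_distr) (auto simp: comp_def T(2))
  finally show ?thesis by simp
qed

end

section \<open>Frullani's integral and the norm of a random image\<close>

text \<open>The integrand is the integral of \<open>exp (- t * s)\<close> over \<open>s\<close>
  between \<open>a\<close> and \<open>b\<close>; integrating over \<open>t\<close> first leaves that
  of \<open>1 / s\<close>.\<close>

lemma nn_integral_frullani:
  assumes "0 < a" "a \<le> b"
  shows "(\<integral>\<^sup>+t. ennreal ((exp (- t * a) - exp (- t * b)) / t) * indicator {0<..} t \<partial>lborel)
    = ennreal (ln b - ln a)"
proof -
  define F where "F t s = ennreal (exp (- t * s)) * indicator {0..} t * indicator {a..b} s" for t s :: real
  have [measurable]: "(\<lambda>(t, s). F t s) \<in> borel_measurable (borel \<Otimes>\<^sub>M borel)"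
    unfolding F_def by measurable
  \<comment> \<open>At \<open>t = 0\<close> the inner integral is \<open>b - a\<close> while the
    target integrand is 0, so this point is discarded as a null set.\<close>
  have ae: "AE t :: real in lborel. t \<noteq> 0" by (rule AE_lborel_singleton)
  have inner: "(\<integral>\<^sup>+s. F t s \<partial>lborel) = ennreal ((exp (- t * a) - exp (- t * b)) / t) * indicator {0<..} t"
    if "t \<noteq> 0" for t
  proof (cases "0 < t")
    case True
    have "(\<integral>\<^sup>+s. F t s \<partial>lborel) = (\<integral>\<^sup>+s. ennreal (exp (- t * s)) * indicator {a..b} s \<partial>lborel)"
      using True by (simp add: F_def)
    also have "\<dots> = ennreal (- exp (- t * b) / t - - exp (- t * a) / t)"
    proof (rule nn_integral_FTC_Icc)
      show "DERIV (\<lambda>s. - exp (- t * s) / t) s :> exp (- t * s)" for s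
        using True by (auto intro!: derivative_eq_intros)
    qed (use assms in auto)
    also have "- exp (- t * b) / t - - exp (- t * a) / t = (exp (- t * a) - exp (- t * b)) / t"
      by (simp add: diff_divide_distrib)
    finally show ?thesis using True by simp
  next
    case False
    then show ?thesis using that by (simp add: F_def)
  qed
  have outer: "(\<integral>\<^sup>+t. F t s \<partial>lborel) = ennreal (1 / s) * indicator {a..b} s" for s
  proof (cases "s \<in> {a..b}")
    case True
    then have s: "0 < s" using assms by simp
    have "(\<integral>\<^sup>+t. F t s \<partial>lborel) = (\<integral>\<^sup>+t. ennreal (exp (- t * s)) * indicator {0..} t \<partial>lborel)"
      using True by (simp add: F_def)
    also have "\<dots> = ennreal (0 - (- exp (- 0 * s) / s))"
    proof (rule nn_integral_FTC_atLeast)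
      show "DERIV (\<lambda>t. - exp (- t * s) / s) t :> exp (- t * s)" for t
        using s by (auto intro!: derivative_eq_intros)
      show "((\<lambda>t. - exp (- t * s) / s) \<longlongrightarrow> 0) at_top"
        using s by real_asymp
    qed auto
    finally show ?thesis using True by simp
  qed (simp add: F_def)
  have "(\<integral>\<^sup>+t. ennreal ((exp (- t * a) - exp (- t * b)) / t) * indicator {0<..} t \<partial>lborel)
      = (\<integral>\<^sup>+t. (\<integral>\<^sup>+s. F t s \<partial>lborel) \<partial>lborel)"
    by (rule nn_integral_cong_AE, rule AE_mp[OF ae], intro AE_I2 impI) (rule inner[symmetric])
  also have "\<dots> = (\<integral>\<^sup>+s. (\<integral>\<^sup>+t. F t s \<partial>lborel) \<partial>lborel)"
    by (rule lborel_pair.Fubini'[symmetric]) simp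
  also have "\<dots> = (\<integral>\<^sup>+s. ennreal (1 / s) * indicator {a..b} s \<partial>lborel)"
    unfolding outer ..
  also have "\<dots> = ennreal (ln b - ln a)"
  proof (rule nn_integral_FTC_Icc)
    show "DERIV ln s :> 1 / s" if "s \<in> {a..b}" for s
      using that assms by (auto intro!: derivative_eq_intros)
  qed (use assms in auto)
  finally show ?thesis .
qed

definition frullani_kernel :: "real \<Rightarrow> real \<Rightarrow> real"
  where "frullani_kernel w t = indicator {0<..} t * ((exp (- t) - exp (- t * w)) / t)"

lemma borel_measurable_frullani_kernel [measurable]:
  "(\<lambda>(w, t). frullani_kernel w t) \<in> borel_measurable (borel \<Otimes>\<^sub>M borel)"
  "frullani_kernel w \<in> borel_measurable borel"
  unfolding frullani_kernel_def[abs_def] by measurable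

text \<open>For fixed \<open>w\<close> the kernel never changes sign, being nonnegative for
  \<open>w \<ge> 1\<close> and nonpositive for \<open>w \<le> 1\<close>. Hence its absolute integral
  is exactly \<open>\<bar>ln w\<bar>\<close>, the bound needed for Fubini.\<close>

lemma has_bochner_integral_frullani:
  assumes "0 < w"
  shows "has_bochner_integral lborel (frullani_kernel w) (ln w)"
    and "has_bochner_integral lborel (\<lambda>t. norm (frullani_kernel w t)) \<bar>ln w\<bar>"
proof -
  have *: "has_bochner_integral lborel (\<lambda>t. indicator {0<..} t * ((exp (- t * a) - exp (- t * b)) / t)) (ln b - ln a)"
    and nn: "0 \<le> indicator {0<..} t * ((exp (- t * a) - exp (- t * b)) / t)"
    if ab: "0 < a" "a \<le> b" for a b t :: real
  proof -
    have nn: "0 \<le> indicator {0<..} t * ((exp (- t * a) - exp (- t * b)) / t)" for t :: real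
      using ab by (auto simp: indicator_def intro!: divide_nonneg_pos mult_left_mono)
    then show "0 \<le> indicator {0<..} t * ((exp (- t * a) - exp (- t * b)) / t)" .
    show "has_bochner_integral lborel (\<lambda>t. indicator {0<..} t * ((exp (- t * a) - exp (- t * b)) / t)) (ln b - ln a)"
    proof (rule has_bochner_integral_nn_integral)
      have "(\<integral>\<^sup>+t. ennreal (indicator {0<..} t * ((exp (- t * a) - exp (- t * b)) / t)) \<partial>lborel)
         = (\<integral>\<^sup>+t. ennreal ((exp (- t * a) - exp (- t * b)) / t) * indicator {0<..} t \<partial>lborel)"
        by (intro nn_integral_cong) (simp add: indicator_def)
      then show "(\<integral>\<^sup>+t. ennreal (indicator {0<..} t * ((exp (- t * a) - exp (- t * b)) / t)) \<partial>lborel) = ennreal (ln b - ln a)"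
        using nn_integral_frullani[OF ab] by simp
    qed (use nn ab in auto)
  qed
  have "has_bochner_integral lborel (frullani_kernel w) (ln w)
    \<and> has_bochner_integral lborel (\<lambda>t. norm (frullani_kernel w t)) \<bar>ln w\<bar>"
  proof (cases "1 \<le> w")
    case True
    have eq: "frullani_kernel w = (\<lambda>t. indicator {0<..} t * ((exp (- t * 1) - exp (- t * w)) / t))"
      by (simp add: frullani_kernel_def[abs_def])
    have "norm (frullani_kernel w t) = frullani_kernel w t" for t
      unfolding eq real_norm_def by (rule abs_of_nonneg[OF nn]) (use True in auto)
    then show ?thesis
      using *[of 1 w] True unfolding eq by simp
  next
    case False
    let ?g = "\<lambda>t. indicator {0<..} t * ((exp (- t * w) - exp (- t * 1)) / t)"
    have eq: "frullani_kernel w t = - ?g t" for t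
      by (simp add: frullani_kernel_def indicator_def diff_divide_distrib)
    have "0 \<le> ?g t" for t
      using nn[of w 1 t] False assms by simp
    then have eq': "norm (frullani_kernel w t) = ?g t" for t
      unfolding eq real_norm_def abs_minus_cancel by (rule abs_of_nonneg)
    have g: "has_bochner_integral lborel ?g (- ln w)"
      using *[of w 1] False assms by simp
    have "frullani_kernel w = (\<lambda>t. - ?g t)"
      by (rule ext) (rule eq)
    then have "has_bochner_integral lborel (frullani_kernel w) (ln w)"
      using has_bochner_integral_minus[OF g] by simp
    moreover have "has_bochner_integral lborel (\<lambda>t. norm (frullani_kernel w t)) \<bar>ln w\<bar>"
      using g False assms unfolding eq' by simp
    ultimately show ?thesis ..
  qed
  then show "has_bochner_integral lborel (frullani_kernel w) (ln w)"
    and "has_bochner_integral lborel (\<lambda>t. norm (frullani_kernel w t)) \<bar>ln w\<bar>" by auto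
qed

text \<open>Fubini on the product of the probability space with the half-line. The absolute integral
  of the kernel over \<open>t\<close> is \<open>\<bar>ln W\<bar>\<close>, so integrability of
  \<open>ln W\<close> is exactly the condition for the exchange.\<close>

lemma (in prob_space) expectation_ln_eq_frullani_integral:
  fixes W :: "'a \<Rightarrow> real"
  assumes [measurable]: "W \<in> borel_measurable M" and pos: "AE \<omega> in M. 0 < W \<omega>"
    and int: "integrable M (\<lambda>\<omega>. ln (W \<omega>))"
  shows "set_integrable lborel {0<..} (\<lambda>t. (exp (- t) - expectation (\<lambda>\<omega>. exp (- t * W \<omega>))) / t)"
    and "expectation (\<lambda>\<omega>. ln (W \<omega>))
      = (LBINT t:{0<..}. (exp (- t) - expectation (\<lambda>\<omega>. exp (- t * W \<omega>))) / t)"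
proof -
  interpret P: pair_sigma_finite M lborel by standard
  define G where "G \<omega> t = frullani_kernel (W \<omega>) t" for \<omega> t
  have [measurable]: "(\<lambda>(\<omega>, t). G \<omega> t) \<in> borel_measurable (M \<Otimes>\<^sub>M lborel)"
    unfolding G_def frullani_kernel_def by measurable
  have [measurable]: "(\<lambda>\<omega>. \<integral>t. norm (G \<omega> t) \<partial>lborel) \<in> borel_measurable M"
    by measurable
  have integrable_G: "integrable (M \<Otimes>\<^sub>M lborel) (\<lambda>(\<omega>, t). G \<omega> t)"
  proof (rule P.Fubini_integrable)
    have "AE \<omega> in M. (\<integral>t. norm (G \<omega> t) \<partial>lborel) = \<bar>ln (W \<omega>)\<bar>"
      by (rule AE_mp[OF pos], intro AE_I2 impI)
        (simp only: G_def has_bochner_integral_integral_eq[OF has_bochner_integral_frullani(2)])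
    then show "integrable M (\<lambda>\<omega>. \<integral>t. norm (case (\<omega>, t) of (\<omega>, t) \<Rightarrow> G \<omega> t) \<partial>lborel)"
      using int by (subst integrable_cong_AE[where g = "\<lambda>\<omega>. \<bar>ln (W \<omega>)\<bar>"]) auto
    show "AE \<omega> in M. integrable lborel (\<lambda>t. case (\<omega>, t) of (\<omega>, t) \<Rightarrow> G \<omega> t)"
      by (rule AE_mp[OF pos], intro AE_I2 impI)
        (auto simp: G_def intro: integrable.intros has_bochner_integral_frullani)
  qed measurable
  have exp_int: "integrable M (\<lambda>\<omega>. exp (- t * W \<omega>))" if "0 < t" for t
    by (rule integrable_const_bound[where B = 1], rule AE_mp[OF pos], intro AE_I2 impI)
      (use that in auto)
  have G_int: "(\<integral>\<omega>. G \<omega> t \<partial>M) = indicator {0<..} t * ((exp (- t) - expectation (\<lambda>\<omega>. exp (- t * W \<omega>))) / t)" for t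
  proof (cases "0 < t")
    case True
    then show ?thesis
      using exp_int[OF True] by (simp add: G_def frullani_kernel_def prob_space)
  qed (simp add: G_def frullani_kernel_def)
  show "set_integrable lborel {0<..} (\<lambda>t. (exp (- t) - expectation (\<lambda>\<omega>. exp (- t * W \<omega>))) / t)"
    using P.integrable_snd[OF integrable_G] by (simp add: set_integrable_def G_int)
  have "(LBINT t:{0<..}. (exp (- t) - expectation (\<lambda>\<omega>. exp (- t * W \<omega>))) / t)
      = (\<integral>t. (\<integral>\<omega>. G \<omega> t \<partial>M) \<partial>lborel)"
    by (simp add: set_lebesgue_integral_def G_int)
  also have "\<dots> = (\<integral>\<omega>. (\<integral>t. G \<omega> t \<partial>lborel) \<partial>M)"
    by (rule P.Fubini_integral[OF integrable_G])
  also have "\<dots> = expectation (\<lambda>\<omega>. ln (W \<omega>))"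
  proof (rule integral_cong_AE)
    show "AE \<omega> in M. (\<integral>t. G \<omega> t \<partial>lborel) = ln (W \<omega>)"
      by (rule AE_mp[OF pos], intro AE_I2 impI)
        (simp only: G_def has_bochner_integral_integral_eq[OF has_bochner_integral_frullani(1)])
  qed measurable
  finally show "expectation (\<lambda>\<omega>. ln (W \<omega>))
      = (LBINT t:{0<..}. (exp (- t) - expectation (\<lambda>\<omega>. exp (- t * W \<omega>))) / t)" by simp
qed

text \<open>For arguments at least 1 this is \<open>ln x \<le> 16 * x powr (1/16)\<close> to the
  fourth power; smaller ones are inverted. The exponent \<open>1/16\<close> is chosen so that
  \<open>-1/4\<close> results, where the moment of a row entry is known to be finite.\<close>

lemma ln_power4_le:
  fixes w :: real
  assumes "0 < w"
  shows "(ln w) ^ 4 \<le> 16 ^ 4 * (w powr (1 / 4) + w powr (- 1 / 4))"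
proof -
  have *: "(ln x) ^ 4 \<le> 16 ^ 4 * x powr (1 / 4)" if "1 \<le> x" for x :: real
  proof -
    have "ln x \<le> x powr (1 / 16) / (1 / 16)"
      using that by (intro ln_powr_bound) auto
    then have "(ln x) ^ 4 \<le> (16 * x powr (1 / 16)) ^ 4"
      using that by (intro power_mono) auto
    also have "\<dots> = 16 ^ 4 * x powr (1 / 4)"
      using that by (simp add: power_mult_distrib powr_power)
    finally show ?thesis .
  qed
  show ?thesis
  proof (cases "1 \<le> w")
    case True
    then show ?thesis using *[of w] by (simp add: add_increasing2)
  next
    case False
    then have "(ln (inverse w)) ^ 4 \<le> 16 ^ 4 * (inverse w) powr (1 / 4)"
      using assms by (intro *) (simp add: one_le_inverse)
    moreover have "(inverse w) powr (1 / 4) = w powr (- 1 / 4)"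
      using assms by (simp add: powr_minus inverse_powr)
    ultimately show ?thesis using assms by (simp add: ln_inverse add_increasing)
  qed
qed

section \<open>The squared norm of \<open>X e\<close> for one random matrix\<close>

lemma borel_measurable_matrix_vector_mult [measurable (raw)]:
  fixes A :: "'w \<Rightarrow> 'a::{real_normed_div_algebra, euclidean_space} ^ 'n ^ 'm"
  assumes [measurable]: "A \<in> borel_measurable M" "v \<in> borel_measurable M"
  shows "(\<lambda>\<omega>. A \<omega> *v v \<omega>) \<in> borel_measurable M"
proof -
  have "continuous_on UNIV (\<lambda>p :: ('a ^ 'n ^ 'm) \<times> ('a ^ 'n). fst p *v snd p)"
    unfolding matrix_vector_mult_def by (intro continuous_intros)
  then have "(\<lambda>p :: ('a ^ 'n ^ 'm) \<times> ('a ^ 'n). fst p *v snd p) \<in> borel_measurable (borel \<Otimes>\<^sub>M borel)"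
    unfolding borel_prod by (rule borel_measurable_continuous_onI)
  from measurable_compose[OF _ this, of "\<lambda>\<omega>. (A \<omega>, v \<omega>)" M] show ?thesis by simp
qed

lemma borel_measurable_row_mult [measurable]:
  fixes e :: "'a::{real_normed_div_algebra, euclidean_space} ^ 'n"
  shows "(\<lambda>x. row_mult x e) \<in> borel_measurable borel"
  unfolding row_mult_def by (intro borel_measurable_continuous_onI continuous_intros)

locale beta_I_matrix_space = prob_space M
  for M :: "'w measure" and \<nu> :: "'n::finite \<Rightarrow> real"
    and X :: "'w \<Rightarrow> 'a::{real_normed_div_algebra, euclidean_space} ^ 'n ^ 'n" +
  assumes \<nu>_pos: "\<And>l. 0 < \<nu> l"
    and X_measurable [measurable]: "X \<in> borel_measurable M"
    and X_beta: "beta_I_matrix M DIM('a) \<nu> X"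
begin

abbreviation row_measure :: "'n \<Rightarrow> ('a ^ 'n) measure"
  where "row_measure l \<equiv> beta_I_measure DIM('a) (\<nu> l)"

lemma row_distr: "distr M borel (\<lambda>\<omega>. X \<omega> $ l) = row_measure l"
  using X_beta unfolding beta_I_matrix_def distributed_def beta_I_measure_def
  by (metis (no_types, lifting) distr_cong sets_lborel)

lemma prob_row_measure: "prob_space (row_measure l)"
  unfolding row_distr[symmetric] by (rule prob_space_distr) measurable

lemma borel_measurable_coordinate_sq [measurable, simp]:
  "(\<lambda>x. (norm (x $ i))\<^sup>2) \<in> borel_measurable (row_measure l)"
proof -
  have "(\<lambda>x. (norm (x $ i))\<^sup>2) \<in> borel_measurable (borel :: ('a ^ 'n) measure)" by measurable
  then show ?thesis by (simp cong: measurable_cong_sets)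
qed

definition row_sq :: "'a ^ 'n \<Rightarrow> 'n \<Rightarrow> 'w \<Rightarrow> real"
  where "row_sq e l \<omega> = (norm (row_mult (X \<omega> $ l) e))\<^sup>2"

lemma borel_measurable_row_sq [measurable]: "row_sq e l \<in> borel_measurable M"
  unfolding row_sq_def[abs_def] by (intro borel_measurable_power borel_measurable_norm
    measurable_compose[OF _ borel_measurable_row_mult]) measurable

lemma norm_sq_eq: "(norm (X \<omega> *v e))\<^sup>2 = (\<Sum>l\<in>UNIV. row_sq e l \<omega>)"
  by (simp add: power2_norm_vec matrix_vector_mult_row_mult row_sq_def)

lemma indep_row_sq: "indep_vars (\<lambda>_. borel) (row_sq e) UNIV"
proof -
  have "indep_vars (\<lambda>_. borel) (\<lambda>l \<omega>. (norm (row_mult (X \<omega> $ l) e))\<^sup>2) UNIV"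
  proof (rule indep_vars_compose2[where Y = "\<lambda>_ x. (norm (row_mult x e))\<^sup>2"])
    show "indep_vars (\<lambda>_. borel) (\<lambda>l \<omega>. X \<omega> $ l) UNIV"
      using X_beta by (simp add: beta_I_matrix_def)
  qed measurable
  then show ?thesis by (simp add: row_sq_def[abs_def])
qed

context
  fixes e :: "'a ^ 'n" and i :: 'n
  assumes e: "norm e = 1"
begin

lemma row_sq_distr:
  "distr M borel (row_sq e l) = distr (row_measure l) borel (\<lambda>x. (norm (x $ i))\<^sup>2)"
proof -
  have "distr M borel (row_sq e l) = distr (row_measure l) borel (\<lambda>x. (norm (row_mult x e))\<^sup>2)"
    unfolding row_distr[symmetric] row_sq_def[abs_def]
    by (subst distr_distr) (auto simp: comp_def)
  also have "\<dots> = distr (row_measure l) borel (\<lambda>x. (norm (x $ i))\<^sup>2)"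
    by (rule beta_I_row_mult_distr[OF \<nu>_pos refl prob_row_measure e])
  finally show ?thesis .
qed

text \<open>The rows are independent, so the law of the sum is an image of the product of the row
  laws. The right-hand side does not contain \<open>e\<close>: this is the form in which rotation
  invariance is used from here on.\<close>

lemma norm_sq_distr:
  "distr M borel (\<lambda>\<omega>. (norm (X \<omega> *v e))\<^sup>2)
    = distr (PiM UNIV (\<lambda>l. distr (row_measure l) borel (\<lambda>x. (norm (x $ i))\<^sup>2))) borel (\<lambda>f. \<Sum>l\<in>UNIV. f l)"
proof -
  have "distr M (PiM UNIV (\<lambda>_. borel)) (\<lambda>\<omega>. \<lambda>l\<in>UNIV. row_sq e l \<omega>) = PiM UNIV (\<lambda>l. distr M borel (row_sq e l))"
    using indep_row_sq by (subst indep_vars_iff_distr_eq_PiM'[symmetric]) auto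
  then have "PiM UNIV (\<lambda>l. distr (row_measure l) borel (\<lambda>x. (norm (x $ i))\<^sup>2))
      = distr M (PiM UNIV (\<lambda>_. borel)) (\<lambda>\<omega>. \<lambda>l\<in>UNIV. row_sq e l \<omega>)"
    by (simp add: row_sq_distr)
  then show ?thesis
    by (simp only:) (subst distr_distr, auto simp: comp_def norm_sq_eq)
qed

lemma AE_row_sq: "AE \<omega> in M. \<forall>l. 0 < row_sq e l \<omega> \<and> row_sq e l \<omega> \<le> 1"
proof -
  have "AE \<omega> in M. 0 < row_sq e l \<omega> \<and> row_sq e l \<omega> \<le> 1" for l
  proof -
    have "AE x in distr (row_measure l) borel (\<lambda>x. (norm (x $ i))\<^sup>2). 0 < x \<and> x \<le> 1"
      using AE_beta_I_measure by (subst AE_distr_iff) auto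
    then have "AE x in distr M borel (row_sq e l). 0 < x \<and> x \<le> 1"
      by (simp only: row_sq_distr)
    then show ?thesis by (subst (asm) AE_distr_iff) auto
  qed
  then show ?thesis by (simp add: AE_all_countable)
qed

text \<open>Each of the \<open>CARD('n)\<close> summands lies between 0 and 1. The lower bound by a
  single row controls negative powers of the squared norm.\<close>

lemma AE_norm_sq: "AE \<omega> in M. 0 < (norm (X \<omega> *v e))\<^sup>2 \<and> (norm (X \<omega> *v e))\<^sup>2 \<le> CARD('n)
    \<and> (\<forall>l. row_sq e l \<omega> \<le> (norm (X \<omega> *v e))\<^sup>2 \<and> 0 < row_sq e l \<omega>)"
proof (rule AE_mp[OF AE_row_sq], intro AE_I2 impI)
  fix \<omega> assume *: "\<forall>l. 0 < row_sq e l \<omega> \<and> row_sq e l \<omega> \<le> 1"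
  then have "(\<Sum>l\<in>UNIV. row_sq e l \<omega>) \<le> (\<Sum>l\<in>(UNIV::'n set). 1)"
    by (intro sum_mono) auto
  moreover have "0 < (\<Sum>l\<in>UNIV. row_sq e l \<omega>)"
    using * by (intro sum_pos) auto
  moreover have "row_sq e l \<omega> \<le> (\<Sum>l\<in>UNIV. row_sq e l \<omega>)" for l
    using * by (intro member_le_sum) (auto intro: less_imp_le)
  ultimately show "0 < (norm (X \<omega> *v e))\<^sup>2 \<and> (norm (X \<omega> *v e))\<^sup>2 \<le> CARD('n)
      \<and> (\<forall>l. row_sq e l \<omega> \<le> (norm (X \<omega> *v e))\<^sup>2 \<and> 0 < row_sq e l \<omega>)"
    using * by (simp add: norm_sq_eq)
qed

lemma norm_sq_laplace:
  assumes "0 \<le> t"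
  shows "expectation (\<lambda>\<omega>. exp (- t * (norm (X \<omega> *v e))\<^sup>2))
    = (\<Prod>l\<in>UNIV. hyp_1F1 (DIM('a) / 2) (DIM('a) * (real CARD('n) + \<nu> l) / 2) (- t))"
proof -
  have indep: "indep_vars (\<lambda>_. borel) (\<lambda>l \<omega>. exp (- t * row_sq e l \<omega>)) UNIV"
    by (rule indep_vars_compose2[where Y = "\<lambda>_ x. exp (- t * x)", OF indep_row_sq]) measurable
  have "expectation (\<lambda>\<omega>. exp (- t * (norm (X \<omega> *v e))\<^sup>2)) = expectation (\<lambda>\<omega>. \<Prod>l\<in>UNIV. exp (- t * row_sq e l \<omega>))"
    by (simp add: norm_sq_eq sum_distrib_left exp_sum)
  also have "\<dots> = (\<Prod>l\<in>UNIV. expectation (\<lambda>\<omega>. exp (- t * row_sq e l \<omega>)))"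
  proof (rule indep_vars_lebesgue_integral[OF finite indep])
    show "integrable M (\<lambda>\<omega>. exp (- t * row_sq e l \<omega>))" for l
      by (rule integrable_const_bound[where B = 1]) (use assms in \<open>auto simp: row_sq_def\<close>)
  qed
  also have "\<dots> = (\<Prod>l\<in>UNIV. hyp_1F1 (DIM('a) / 2) (DIM('a) * (real CARD('n) + \<nu> l) / 2) (- t))"
  proof (rule prod.cong[OF refl])
    fix l
    have "expectation (\<lambda>\<omega>. exp (- t * row_sq e l \<omega>)) = (\<integral>x. exp (- t * x) \<partial>distr M borel (row_sq e l))"
      by (subst integral_distr) auto
    also have "\<dots> = (\<integral>x. exp (- t * (norm (x $ i))\<^sup>2) \<partial>row_measure l)"
      unfolding row_sq_distr by (subst integral_distr) auto
    also have "\<dots> = hyp_1F1 (DIM('a) / 2) (DIM('a) * (real CARD('n) + \<nu> l) / 2) (- t)"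
      by (rule beta_I_coordinate_laplace[OF \<nu>_pos refl prob_row_measure assms])
    finally show "expectation (\<lambda>\<omega>. exp (- t * row_sq e l \<omega>))
      = hyp_1F1 (DIM('a) / 2) (DIM('a) * (real CARD('n) + \<nu> l) / 2) (- t)" .
  qed
  finally show ?thesis .
qed

text \<open>Large values are harmless because the squared norm is at most \<open>CARD('n)\<close>;
  near 0 it dominates the contribution of row \<open>i\<close>, whose moment of order
  \<open>-1/4\<close> is finite.\<close>

lemma integrable_ln_norm_sq_power4: "integrable M (\<lambda>\<omega>. (ln ((norm (X \<omega> *v e))\<^sup>2)) ^ 4)"
proof (rule integrableI_bounded)
  have "(\<integral>\<^sup>+\<omega>. ennreal (row_sq e i \<omega> powr (- 1 / 4)) \<partial>M) = (\<integral>\<^sup>+x. ennreal (x powr (- 1 / 4)) \<partial>distr M borel (row_sq e i))"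
    by (subst nn_integral_distr) auto
  also have "\<dots> = (\<integral>\<^sup>+x. ennreal ((norm (x $ i))\<^sup>2 powr (- 1 / 4)) \<partial>row_measure i)"
    unfolding row_sq_distr by (subst nn_integral_distr) auto
  also have "\<dots> < top"
    by (rule beta_I_coordinate_negative_moment[OF \<nu>_pos refl prob_row_measure])
  finally have fin: "(\<integral>\<^sup>+\<omega>. ennreal (row_sq e i \<omega> powr (- 1 / 4)) \<partial>M) < top" .
  have "(\<integral>\<^sup>+\<omega>. ennreal (norm ((ln ((norm (X \<omega> *v e))\<^sup>2)) ^ 4)) \<partial>M)
      \<le> (\<integral>\<^sup>+\<omega>. ennreal (16 ^ 4) * (ennreal (real CARD('n) powr (1 / 4)) + ennreal (row_sq e i \<omega> powr (- 1 / 4))) \<partial>M)"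
  proof (rule nn_integral_mono_AE, rule AE_mp[OF AE_norm_sq], intro AE_I2 impI)
    fix \<omega>
    let ?w = "(norm (X \<omega> *v e))\<^sup>2"
    assume *: "0 < ?w \<and> ?w \<le> CARD('n) \<and> (\<forall>l. row_sq e l \<omega> \<le> ?w \<and> 0 < row_sq e l \<omega>)"
    have "(ln ?w) ^ 4 \<le> 16 ^ 4 * (?w powr (1 / 4) + ?w powr (- 1 / 4))"
      using * by (intro ln_power4_le) auto
    also have "\<dots> \<le> 16 ^ 4 * (real CARD('n) powr (1 / 4) + row_sq e i \<omega> powr (- 1 / 4))"
      using * by (intro mult_left_mono add_mono powr_mono2 powr_mono2') auto
    finally have le: "norm ((ln ?w) ^ 4) \<le> 16 ^ 4 * (real CARD('n) powr (1 / 4) + row_sq e i \<omega> powr (- 1 / 4))"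
      by simp
    have eq: "ennreal (c * (x + y)) = ennreal c * (ennreal x + ennreal y)" if "0 \<le> c" "0 \<le> x" "0 \<le> y" for c x y
      using that by (simp add: ennreal_mult)
    show "ennreal (norm ((ln ?w) ^ 4))
        \<le> ennreal (16 ^ 4) * (ennreal (real CARD('n) powr (1 / 4)) + ennreal (row_sq e i \<omega> powr (- 1 / 4)))"
      using ennreal_leI[OF le] by (subst (asm) eq) auto
  qed
  also have "\<dots> = ennreal (16 ^ 4) * (ennreal (real CARD('n) powr (1 / 4)) + (\<integral>\<^sup>+\<omega>. ennreal (row_sq e i \<omega> powr (- 1 / 4)) \<partial>M))"
    by (simp add: nn_integral_cmult nn_integral_add emeasure_space_1)
  also have "\<dots> < top"
    using fin by (simp add: ennreal_mult_less_top)
  finally show "(\<integral>\<^sup>+\<omega>. ennreal (norm ((ln ((norm (X \<omega> *v e))\<^sup>2)) ^ 4)) \<partial>M) < \<infinity>" by simp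
qed measurable

end

end

section \<open>A strong law from fourth moments\<close>

lemma (in prob_space) integrable_power_le:
  fixes Z :: "'a \<Rightarrow> real"
  assumes [measurable]: "Z \<in> borel_measurable M" and int: "integrable M (\<lambda>\<omega>. Z \<omega> ^ 4)" and k: "k \<le> 4"
  shows "integrable M (\<lambda>\<omega>. Z \<omega> ^ k)"
proof (rule Bochner_Integration.integrable_bound)
  show "integrable M (\<lambda>\<omega>. 1 + Z \<omega> ^ 4)" using int by simp
  have "\<bar>x\<bar> ^ k \<le> 1 + x ^ 4" for x :: real
  proof (cases "\<bar>x\<bar> \<le> 1")
    case True
    then have "\<bar>x\<bar> ^ k \<le> 1" by (simp add: power_le_one)
    moreover have "0 \<le> x ^ 4" by simp
    ultimately show ?thesis by linarith
  next
    case False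
    then have "\<bar>x\<bar> ^ k \<le> \<bar>x\<bar> ^ 4" using k by (intro power_increasing) auto
    then show ?thesis by simp
  qed
  then show "AE \<omega> in M. norm (Z \<omega> ^ k) \<le> norm (1 + Z \<omega> ^ 4)"
    by (intro AE_I2) (simp add: power_abs abs_of_nonneg)
qed measurable

lemma power4_sum: "(x + y) ^ 4 = x ^ 4 + 4 * (x ^ 3 * y) + 6 * (x ^ 2 * y ^ 2) + 4 * (x * y ^ 3) + y ^ 4"
  for x y :: real
  by algebra

context prob_space
begin

context
  fixes S Z :: "nat \<Rightarrow> 'a \<Rightarrow> real" and B :: real
  assumes S_0: "\<And>\<omega>. S 0 \<omega> = 0"
    and S_Suc: "\<And>m. AE \<omega> in M. S (Suc m) \<omega> = S m \<omega> + Z m \<omega>"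
    and indep: "\<And>m. indep_var borel (S m) borel (Z m)"
    and Z_mean: "\<And>m. expectation (Z m) = 0"
    and Z_int: "\<And>m. integrable M (\<lambda>\<omega>. Z m \<omega> ^ 4)"
    and Z_bound: "\<And>m. expectation (\<lambda>\<omega>. Z m \<omega> ^ 4) \<le> B"
begin

lemma S_meas [measurable]: "S m \<in> borel_measurable M"
  using indep_var_rv1[OF indep[of m]] .

lemma Z_meas [measurable]: "Z m \<in> borel_measurable M"
  using indep_var_rv2[OF indep[of m]] .

lemma Z_square_bound: "expectation (\<lambda>\<omega>. Z m \<omega> ^ 2) \<le> 1 + B"
proof -
  have "expectation (\<lambda>\<omega>. Z m \<omega> ^ 2) \<le> expectation (\<lambda>\<omega>. 1 + Z m \<omega> ^ 4)"
  proof (rule integral_mono)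
    fix \<omega>
    have "0 \<le> (Z m \<omega> ^ 2 - 1) ^ 2 + Z m \<omega> ^ 2" by simp
    then show "Z m \<omega> ^ 2 \<le> 1 + Z m \<omega> ^ 4" by (simp add: power2_eq_square power4_eq_xxxx algebra_simps)
  qed (use integrable_power_le[OF Z_meas Z_int, of 2] Z_int in auto)
  also have "\<dots> \<le> 1 + B" using Z_bound[of m] Z_int[of m] by (simp add: prob_space)
  finally show ?thesis .
qed

lemma S_power_Z_power:
  assumes "integrable M (\<lambda>\<omega>. S m \<omega> ^ 4)" "j \<le> 4" "k \<le> 4"
  shows "integrable M (\<lambda>\<omega>. S m \<omega> ^ j * Z m \<omega> ^ k)"
    and "expectation (\<lambda>\<omega>. S m \<omega> ^ j * Z m \<omega> ^ k)
      = expectation (\<lambda>\<omega>. S m \<omega> ^ j) * expectation (\<lambda>\<omega>. Z m \<omega> ^ k)"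
proof -
  have *: "indep_var borel (\<lambda>\<omega>. S m \<omega> ^ j) borel (\<lambda>\<omega>. Z m \<omega> ^ k)"
    using indep_var_compose[OF indep[of m], of "\<lambda>x. x ^ j" borel "\<lambda>x. x ^ k" borel]
    by (simp add: comp_def)
  have i: "integrable M (\<lambda>\<omega>. S m \<omega> ^ j)" "integrable M (\<lambda>\<omega>. Z m \<omega> ^ k)"
    using integrable_power_le[OF S_meas assms(1,2)] integrable_power_le[OF Z_meas Z_int assms(3)] by auto
  show "integrable M (\<lambda>\<omega>. S m \<omega> ^ j * Z m \<omega> ^ k)"
    by (rule indep_var_integrable[OF * i])
  show "expectation (\<lambda>\<omega>. S m \<omega> ^ j * Z m \<omega> ^ k)
      = expectation (\<lambda>\<omega>. S m \<omega> ^ j) * expectation (\<lambda>\<omega>. Z m \<omega> ^ k)"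
    by (rule indep_var_lebesgue_integral[OF * i])
qed

lemma B_nonneg: "0 \<le> B"
  using Z_bound[of 0] by (rule order_trans[rotated]) (intro integral_nonneg_AE AE_I2, simp)

text \<open>In the expansion of \<open>(S + Z)^4\<close> the terms with \<open>S^3 Z\<close> and
  \<open>S Z^3\<close> vanish, as both means are 0. The rest grows by at most
  \<open>6 m (1 + B)^2 + B\<close>, which is at most \<open>3 (1 + B)^2 (2 m + 1)\<close>; this
  explains the constant 3. The second moment is carried along for the term
  \<open>6 S^2 Z^2\<close>.\<close>

lemma S_moments:
  "integrable M (\<lambda>\<omega>. S m \<omega> ^ 4) \<and> expectation (S m) = 0
    \<and> expectation (\<lambda>\<omega>. S m \<omega> ^ 2) \<le> real m * (1 + B)
    \<and> expectation (\<lambda>\<omega>. S m \<omega> ^ 4) \<le> 3 * (1 + B)\<^sup>2 * (real m)\<^sup>2"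
proof (induction m)
  case 0
  then show ?case by (simp add: S_0)
next
  case (Suc m)
  then have S4: "integrable M (\<lambda>\<omega>. S m \<omega> ^ 4)" and S1: "expectation (S m) = 0"
    and S2: "expectation (\<lambda>\<omega>. S m \<omega> ^ 2) \<le> real m * (1 + B)"
    and S4': "expectation (\<lambda>\<omega>. S m \<omega> ^ 4) \<le> 3 * (1 + B)\<^sup>2 * (real m)\<^sup>2" by auto
  note P = S_power_Z_power[OF S4]
  have Sk: "integrable M (\<lambda>\<omega>. S m \<omega> ^ k)" if "k \<le> 4" for k
    by (rule integrable_power_le[OF S_meas S4 that])
  have Zk: "integrable M (\<lambda>\<omega>. Z m \<omega> ^ k)" if "k \<le> 4" for k
    by (rule integrable_power_le[OF Z_meas Z_int that])
  have cong: "integrable M (\<lambda>\<omega>. S (Suc m) \<omega> ^ k) \<longleftrightarrow> integrable M (\<lambda>\<omega>. (S m \<omega> + Z m \<omega>) ^ k)"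
    "expectation (\<lambda>\<omega>. S (Suc m) \<omega> ^ k) = expectation (\<lambda>\<omega>. (S m \<omega> + Z m \<omega>) ^ k)" for k
  proof -
    have ae: "AE \<omega> in M. S (Suc m) \<omega> ^ k = (S m \<omega> + Z m \<omega>) ^ k"
      using S_Suc[of m] by eventually_elim simp
    show "integrable M (\<lambda>\<omega>. S (Suc m) \<omega> ^ k) \<longleftrightarrow> integrable M (\<lambda>\<omega>. (S m \<omega> + Z m \<omega>) ^ k)"
      by (rule integrable_cong_AE[OF _ _ ae]) measurable
    show "expectation (\<lambda>\<omega>. S (Suc m) \<omega> ^ k) = expectation (\<lambda>\<omega>. (S m \<omega> + Z m \<omega>) ^ k)"
      by (rule integral_cong_AE[OF _ _ ae]) measurable
  qed
  have e1: "expectation (\<lambda>\<omega>. S (Suc m) \<omega> ^ 1) = 0"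
    using Sk[of 1] Zk[of 1] S1 Z_mean[of m] unfolding cong by simp
  have "expectation (\<lambda>\<omega>. S (Suc m) \<omega> ^ 2)
      = expectation (\<lambda>\<omega>. S m \<omega> ^ 2 + 2 * (S m \<omega> ^ 1 * Z m \<omega> ^ 1) + Z m \<omega> ^ 2)"
    unfolding cong by (simp add: power2_sum algebra_simps)
  also have "\<dots> = expectation (\<lambda>\<omega>. S m \<omega> ^ 2) + 2 * expectation (\<lambda>\<omega>. S m \<omega> ^ 1 * Z m \<omega> ^ 1) + expectation (\<lambda>\<omega>. Z m \<omega> ^ 2)"
    using Sk[of 2] Zk[of 2] P(1)[of 1 1] by simp
  also have "expectation (\<lambda>\<omega>. S m \<omega> ^ 1 * Z m \<omega> ^ 1) = 0"
    using P(2)[of 1 1] S1 by simp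
  finally have e2: "expectation (\<lambda>\<omega>. S (Suc m) \<omega> ^ 2) \<le> real (Suc m) * (1 + B)"
    using S2 Z_square_bound[of m] by (simp add: algebra_simps)
  have sum_int: "integrable M (\<lambda>\<omega>. (S m \<omega> + Z m \<omega>) ^ 4)"
    unfolding power4_sum
    using S4 Zk[of 4] P(1)[of 3 1] P(1)[of 2 2] P(1)[of 1 3]
    by (intro Bochner_Integration.integrable_add integrable_mult_right) simp_all
  have "expectation (\<lambda>\<omega>. S (Suc m) \<omega> ^ 4) = expectation (\<lambda>\<omega>. S m \<omega> ^ 4
      + 4 * (S m \<omega> ^ 3 * Z m \<omega> ^ 1) + 6 * (S m \<omega> ^ 2 * Z m \<omega> ^ 2) + 4 * (S m \<omega> ^ 1 * Z m \<omega> ^ 3) + Z m \<omega> ^ 4)"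
    unfolding cong power4_sum by simp
  also have "\<dots> = expectation (\<lambda>\<omega>. S m \<omega> ^ 4) + 4 * expectation (\<lambda>\<omega>. S m \<omega> ^ 3 * Z m \<omega> ^ 1)
      + 6 * expectation (\<lambda>\<omega>. S m \<omega> ^ 2 * Z m \<omega> ^ 2) + 4 * expectation (\<lambda>\<omega>. S m \<omega> ^ 1 * Z m \<omega> ^ 3)
      + expectation (\<lambda>\<omega>. Z m \<omega> ^ 4)"
    using S4 Zk[of 4] P(1)[of 3 1] P(1)[of 2 2] P(1)[of 1 3] by simp
  also have "expectation (\<lambda>\<omega>. S m \<omega> ^ 3 * Z m \<omega> ^ 1) = 0"
    using P(2)[of 3 1] Z_mean[of m] by simp
  also have "expectation (\<lambda>\<omega>. S m \<omega> ^ 1 * Z m \<omega> ^ 3) = 0"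
    using P(2)[of 1 3] S1 by simp
  also have "expectation (\<lambda>\<omega>. S m \<omega> ^ 2 * Z m \<omega> ^ 2)
      = expectation (\<lambda>\<omega>. S m \<omega> ^ 2) * expectation (\<lambda>\<omega>. Z m \<omega> ^ 2)"
    by (rule P(2)) auto
  finally have "expectation (\<lambda>\<omega>. S (Suc m) \<omega> ^ 4)
      = expectation (\<lambda>\<omega>. S m \<omega> ^ 4) + 6 * (expectation (\<lambda>\<omega>. S m \<omega> ^ 2) * expectation (\<lambda>\<omega>. Z m \<omega> ^ 2))
        + expectation (\<lambda>\<omega>. Z m \<omega> ^ 4)" by simp
  moreover have "expectation (\<lambda>\<omega>. S m \<omega> ^ 2) * expectation (\<lambda>\<omega>. Z m \<omega> ^ 2) \<le> (real m * (1 + B)) * (1 + B)"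
    using S2 Z_square_bound[of m] B_nonneg by (intro mult_mono) (auto intro!: integral_nonneg_AE)
  moreover have "B \<le> 3 * (1 + B)\<^sup>2"
    using B_nonneg by (simp add: power2_eq_square algebra_simps)
  ultimately have "expectation (\<lambda>\<omega>. S (Suc m) \<omega> ^ 4)
      \<le> 3 * (1 + B)\<^sup>2 * (real m)\<^sup>2 + 6 * ((real m * (1 + B)) * (1 + B)) + 3 * (1 + B)\<^sup>2"
    using S4' Z_bound[of m] by linarith
  also have "\<dots> = 3 * (1 + B)\<^sup>2 * (real (Suc m))\<^sup>2"
    by (simp add: power2_eq_square algebra_simps)
  finally show ?case using e1 e2 sum_int cong(1)[of 4] by simp
qed

text \<open>The fourth moment of \<open>S m / m\<close> is of order \<open>1 / m^2\<close>, which is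
  summable. So the series of these fourth powers is almost surely finite and its terms tend to
  0.\<close>

lemma strong_law_fourth_moment: "AE \<omega> in M. (\<lambda>m. S m \<omega> / real m) \<longlonglongrightarrow> 0"
proof -
  \<comment> \<open>The index shift keeps the division by 0 at \<open>m = 0\<close> out of the
    series.\<close>
  define f where "f m \<omega> = (S (Suc m) \<omega> / real (Suc m)) ^ 4" for m \<omega>
  have [measurable]: "f m \<in> borel_measurable M" for m unfolding f_def[abs_def] by measurable
  have f_le: "(\<integral>\<^sup>+\<omega>. ennreal (f m \<omega>) \<partial>M) \<le> ennreal (3 * (1 + B)\<^sup>2 * (1 / real (Suc m) ^ 2))" for m
  proof -
    have "(\<integral>\<^sup>+\<omega>. ennreal (f m \<omega>) \<partial>M) = ennreal (expectation (f m))"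
      using S_moments[of "Suc m"]
      by (intro nn_integral_eq_integral) (auto simp: f_def[abs_def] power_divide)
    also have "expectation (f m) = expectation (\<lambda>\<omega>. S (Suc m) \<omega> ^ 4) / real (Suc m) ^ 4"
      by (simp add: f_def[abs_def] power_divide)
    also have "\<dots> \<le> 3 * (1 + B)\<^sup>2 * (real (Suc m))\<^sup>2 / real (Suc m) ^ 4"
      using S_moments[of "Suc m"] by (intro divide_right_mono) auto
    also have "\<dots> = 3 * (1 + B)\<^sup>2 * (1 / real (Suc m) ^ 2)"
    proof -
      have "c * x\<^sup>2 / x ^ 4 = c * (1 / x ^ 2)" if "x \<noteq> 0" for c x :: real
        using that by (simp add: power4_eq_xxxx power2_eq_square)
      then show ?thesis by (simp only: of_nat_eq_0_iff nat.distinct not_False_eq_True)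
    qed
    finally show ?thesis by (simp add: ennreal_leI)
  qed
  have "summable (\<lambda>m. inverse (real (Suc m) ^ 2))"
    using inverse_power_summable[of 2, where 'a = real]
    by (subst summable_Suc_iff) simp_all
  then have "summable (\<lambda>m. 3 * (1 + B)\<^sup>2 * (1 / real (Suc m) ^ 2))"
    unfolding inverse_eq_divide by (rule summable_mult)
  then have fin: "(\<Sum>m. ennreal (3 * (1 + B)\<^sup>2 * (1 / real (Suc m) ^ 2))) \<noteq> top"
    by (subst suminf_ennreal2) auto
  have "(\<integral>\<^sup>+\<omega>. (\<Sum>m. ennreal (f m \<omega>)) \<partial>M) = (\<Sum>m. \<integral>\<^sup>+\<omega>. ennreal (f m \<omega>) \<partial>M)"
    by (rule nn_integral_suminf) measurable
  also have "\<dots> \<le> (\<Sum>m. ennreal (3 * (1 + B)\<^sup>2 * (1 / real (Suc m) ^ 2)))"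
    by (intro suminf_le f_le) auto
  finally have "(\<integral>\<^sup>+\<omega>. (\<Sum>m. ennreal (f m \<omega>)) \<partial>M) \<noteq> \<infinity>"
    using fin by (auto simp: top_unique)
  then have "AE \<omega> in M. (\<Sum>m. ennreal (f m \<omega>)) \<noteq> \<infinity>"
    by (intro nn_integral_noteq_infinite) measurable
  then show ?thesis
  proof (rule AE_mp, intro AE_I2 impI)
    fix \<omega> assume "(\<Sum>m. ennreal (f m \<omega>)) \<noteq> \<infinity>"
    then have "summable (\<lambda>m. f m \<omega>)"
      by (intro summable_suminf_not_top) (auto simp: f_def)
    then have "(\<lambda>m. f m \<omega>) \<longlonglongrightarrow> 0" by (rule summable_LIMSEQ_zero)
    then have "(\<lambda>m. sqrt (sqrt (f m \<omega>))) \<longlonglongrightarrow> sqrt (sqrt 0)"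
      by (intro tendsto_real_sqrt)
    moreover have "sqrt (sqrt (x ^ 4)) = \<bar>x\<bar>" for x :: real
    proof -
      have "x ^ 4 = (x\<^sup>2)\<^sup>2" by simp
      then show ?thesis by (simp only: real_sqrt_abs abs_power2)
    qed
    ultimately have "(\<lambda>m. \<bar>S (Suc m) \<omega> / real (Suc m)\<bar>) \<longlonglongrightarrow> 0"
      by (simp add: f_def)
    then have "(\<lambda>m. S (Suc m) \<omega> / real (Suc m)) \<longlonglongrightarrow> 0"
      by (simp only: tendsto_rabs_zero_iff)
    then show "(\<lambda>m. S m \<omega> / real m) \<longlonglongrightarrow> 0"
      by (rule LIMSEQ_imp_Suc)
  qed
qed

end

end

section \<open>Independence along the product\<close>

lemma matrix_vector_mult_scaleR_right:
  fixes A :: "'a::real_algebra_1 ^ 'n ^ 'm"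
  shows "A *v (c *\<^sub>R x) = c *\<^sub>R (A *v x)"
  by (simp add: matrix_vector_mult_def vec_eq_iff scaleR_sum_right)

text \<open>The default \<open>e\<close> at \<open>v = 0\<close> makes the result a unit vector for
  every \<open>v\<close>, so the law of the next step is the same for all \<open>v\<close> and no
  exceptional set has to be removed.\<close>

definition normalize_vec :: "'v::real_normed_vector \<Rightarrow> 'v \<Rightarrow> 'v"
  where "normalize_vec e v = (if v = 0 then e else (1 / norm v) *\<^sub>R v)"

lemma norm_normalize_vec: "norm e = 1 \<Longrightarrow> norm (normalize_vec e v) = 1"
  by (simp add: normalize_vec_def)

lemma borel_measurable_normalize_vec [measurable]:
  "normalize_vec e \<in> borel_measurable (borel :: 'v::euclidean_space measure)"
  unfolding normalize_vec_def[abs_def] by measurable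

text \<open>\<^const>\<open>prob_space.indep_var\<close> requires both variables to have the same type, so independence of
  a vector from a matrix is stated as factorisation of the joint law.\<close>

lemma (in prob_space) pair_distr_compose:
  assumes VQ: "distr M (S \<Otimes>\<^sub>M T) (\<lambda>\<omega>. (V \<omega>, Q \<omega>)) = distr M S V \<Otimes>\<^sub>M distr M T Q"
    and V: "V \<in> M \<rightarrow>\<^sub>M S" and Q: "Q \<in> M \<rightarrow>\<^sub>M T" and f: "f \<in> S \<rightarrow>\<^sub>M S'" and g: "g \<in> T \<rightarrow>\<^sub>M T'"
  shows "distr M (S' \<Otimes>\<^sub>M T') (\<lambda>\<omega>. (f (V \<omega>), g (Q \<omega>)))
    = distr M S' (\<lambda>\<omega>. f (V \<omega>)) \<Otimes>\<^sub>M distr M T' (\<lambda>\<omega>. g (Q \<omega>))"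
proof -
  note [measurable] = V Q f g
  have gQ: "(\<lambda>\<omega>. g (Q \<omega>)) \<in> M \<rightarrow>\<^sub>M T'" by measurable
  have eq: "distr (distr M T Q) T' g = distr M T' (\<lambda>\<omega>. g (Q \<omega>))"
    by (subst distr_distr) (auto simp: comp_def)
  have sf: "sigma_finite_measure (distr (distr M T Q) T' g)"
    unfolding eq using prob_space_distr[OF gQ] by (rule prob_space_imp_sigma_finite)
  have "distr M S' (\<lambda>\<omega>. f (V \<omega>)) \<Otimes>\<^sub>M distr M T' (\<lambda>\<omega>. g (Q \<omega>))
      = distr (distr M S V) S' f \<Otimes>\<^sub>M distr (distr M T Q) T' g"
    by (subst (1 2) distr_distr) (auto simp: comp_def)
  also have "\<dots> = distr (distr M S V \<Otimes>\<^sub>M distr M T Q) (S' \<Otimes>\<^sub>M T') (\<lambda>(x, y). (f x, g y))"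
    by (rule pair_measure_distr[OF _ _ sf]) auto
  also have "\<dots> = distr M (S' \<Otimes>\<^sub>M T') (\<lambda>\<omega>. (f (V \<omega>), g (Q \<omega>)))"
    unfolding VQ[symmetric] by (subst distr_distr) (auto simp: comp_def)
  finally show ?thesis by simp
qed

context beta_I_matrix_space
begin

context
  fixes V :: "'w \<Rightarrow> 'a ^ 'n" and e :: "'a ^ 'n" and Q :: "'w \<Rightarrow> real" and \<rho> :: "real measure"
  assumes V_meas [measurable]: "V \<in> borel_measurable M"
    and indep: "distr M (borel \<Otimes>\<^sub>M borel) (\<lambda>\<omega>. (V \<omega>, X \<omega>)) = distr M borel V \<Otimes>\<^sub>M distr M borel X"
    and e: "norm e = 1"
  defines "Q \<equiv> \<lambda>\<omega>. (norm (X \<omega> *v normalize_vec e (V \<omega>)))\<^sup>2"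
    and "\<rho> \<equiv> distr M borel (\<lambda>\<omega>. (norm (X \<omega> *v e))\<^sup>2)"
begin

lemma normalize_V_meas [measurable]: "(\<lambda>\<omega>. normalize_vec e (V \<omega>)) \<in> borel_measurable M"
  by (rule measurable_compose[OF V_meas borel_measurable_normalize_vec])

lemma Q_meas [measurable]: "Q \<in> borel_measurable M"
  unfolding Q_def by measurable

lemma prob_space_\<rho>: "prob_space \<rho>"
  unfolding \<rho>_def by (rule prob_space_distr) measurable

lemma sets_\<rho> [measurable_cong, simp]: "sets \<rho> = sets borel"
  by (simp add: \<rho>_def)

text \<open>Given \<open>V = v\<close>, the matrix \<open>X\<close> acts on the fixed unit vector
  \<open>normalize_vec e v\<close>, and the resulting law \<open>\<rho>\<close> does not depend on
  \<open>v\<close>.\<close>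

lemma nn_integral_joint:
  assumes f: "(\<lambda>(v, q). f v q) \<in> borel_measurable (borel \<Otimes>\<^sub>M borel)"
  shows "(\<integral>\<^sup>+\<omega>. f (V \<omega>) (Q \<omega>) \<partial>M) = (\<integral>\<^sup>+v. \<integral>\<^sup>+q. f v q \<partial>\<rho> \<partial>distr M borel V)"
proof -
  interpret X: prob_space "distr M borel X" by (rule prob_space_distr) measurable
  define g where "g v A = f v ((norm (A *v normalize_vec e v))\<^sup>2)" for v :: "'a ^ 'n" and A :: "'a ^ 'n ^ 'n"
  have [measurable]: "(\<lambda>p. normalize_vec e (fst p)) \<in> borel_measurable (borel \<Otimes>\<^sub>M borel :: (('a ^ 'n) \<times> ('a ^ 'n ^ 'n)) measure)"
    by (rule measurable_compose[OF measurable_fst borel_measurable_normalize_vec])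
  have pair: "(\<lambda>p. (fst p, (norm (snd p *v normalize_vec e (fst p)))\<^sup>2))
      \<in> (borel \<Otimes>\<^sub>M borel :: (('a ^ 'n) \<times> ('a ^ 'n ^ 'n)) measure) \<rightarrow>\<^sub>M borel \<Otimes>\<^sub>M borel"
    by measurable
  have g [measurable]: "(\<lambda>(v, A). g v A) \<in> borel_measurable (borel \<Otimes>\<^sub>M borel)"
    using measurable_compose[OF pair f] by (simp add: g_def case_prod_beta')
  have "(\<integral>\<^sup>+\<omega>. f (V \<omega>) (Q \<omega>) \<partial>M) = (\<integral>\<^sup>+p. (\<lambda>(v, A). g v A) p \<partial>distr M (borel \<Otimes>\<^sub>M borel) (\<lambda>\<omega>. (V \<omega>, X \<omega>)))"
    by (subst nn_integral_distr) (auto simp: g_def Q_def)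
  also have "distr M (borel \<Otimes>\<^sub>M borel) (\<lambda>\<omega>. (V \<omega>, X \<omega>)) = distr M borel V \<Otimes>\<^sub>M distr M borel X"
    by (rule indep)
  also have "(\<integral>\<^sup>+p. (\<lambda>(v, A). g v A) p \<partial>(distr M borel V \<Otimes>\<^sub>M distr M borel X))
      = (\<integral>\<^sup>+v. \<integral>\<^sup>+A. g v A \<partial>distr M borel X \<partial>distr M borel V)"
    by (subst X.nn_integral_fst[symmetric]) (auto cong: measurable_cong_sets sets_pair_measure_cong)
  also have "\<dots> = (\<integral>\<^sup>+v. \<integral>\<^sup>+q. f v q \<partial>\<rho> \<partial>distr M borel V)"
  proof (rule nn_integral_cong)
    fix v
    \<comment> \<open>Both unit vectors give the same explicit law; \<open>undefined\<close> is just
      some reference coordinate.\<close>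
    have law: "distr M borel (\<lambda>\<omega>. (norm (X \<omega> *v normalize_vec e v))\<^sup>2) = \<rho>"
      unfolding \<rho>_def norm_sq_distr[OF norm_normalize_vec[OF e], where i = undefined]
      norm_sq_distr[OF e, where i = undefined] ..
    have fv: "(\<lambda>q. f v q) \<in> borel_measurable borel"
      using measurable_compose[OF measurable_Pair1' f, of v] by simp
    have gv: "(\<lambda>A. g v A) \<in> borel_measurable borel"
      using measurable_compose[OF measurable_Pair1' g, of v] by simp
    have "(\<integral>\<^sup>+A. g v A \<partial>distr M borel X) = (\<integral>\<^sup>+\<omega>. f v ((norm (X \<omega> *v normalize_vec e v))\<^sup>2) \<partial>M)"
      using gv by (subst nn_integral_distr) (auto simp: g_def)
    also have "\<dots> = (\<integral>\<^sup>+q. f v q \<partial>distr M borel (\<lambda>\<omega>. (norm (X \<omega> *v normalize_vec e v))\<^sup>2))"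
      using fv by (subst nn_integral_distr) auto
    finally show "(\<integral>\<^sup>+A. g v A \<partial>distr M borel X) = (\<integral>\<^sup>+q. f v q \<partial>\<rho>)" unfolding law .
  qed
  finally show ?thesis .
qed

lemma Q_distr: "distr M borel Q = \<rho>"
proof (rule measure_eqI)
  interpret V: prob_space "distr M borel V" by (rule prob_space_distr) measurable
  fix A assume "A \<in> sets (distr M borel Q)"
  then have A [measurable]: "A \<in> sets borel" by simp
  have "emeasure (distr M borel Q) A = (\<integral>\<^sup>+\<omega>. indicator A (Q \<omega>) \<partial>M)"
    using nn_integral_distr[of Q M borel "indicator A"] by simp
  also have "\<dots> = (\<integral>\<^sup>+v. \<integral>\<^sup>+q. indicator A q \<partial>\<rho> \<partial>distr M borel V)"
    by (rule nn_integral_joint) measurable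
  also have "\<dots> = emeasure \<rho> A"
    using V.emeasure_space_1 by simp
  finally show "emeasure (distr M borel Q) A = emeasure \<rho> A" .
qed simp

text \<open>With indicators as \<open>f\<close>, \<open>nn_integral_joint\<close> says that the
  joint law of \<open>V\<close> and \<open>Q\<close> is a product. Passing to real-valued functions
  of both gives the form that the strong law takes.\<close>

lemma indep_V_Q:
  fixes f :: "'a ^ 'n \<Rightarrow> real" and g :: "real \<Rightarrow> real"
  assumes f: "f \<in> borel_measurable borel" and g: "g \<in> borel_measurable borel"
  shows "indep_var borel (\<lambda>\<omega>. f (V \<omega>)) borel (\<lambda>\<omega>. g (Q \<omega>))"
proof -
  interpret \<rho>: prob_space \<rho> by (rule prob_space_\<rho>)
  have "distr M borel V \<Otimes>\<^sub>M \<rho> = distr M (borel \<Otimes>\<^sub>M borel) (\<lambda>\<omega>. (V \<omega>, Q \<omega>))"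
  proof (rule measure_eqI)
    show sets: "sets (distr M borel V \<Otimes>\<^sub>M \<rho>) = sets (distr M (borel \<Otimes>\<^sub>M borel) (\<lambda>\<omega>. (V \<omega>, Q \<omega>)))"
      by (simp cong: sets_pair_measure_cong)
    fix A assume "A \<in> sets (distr M borel V \<Otimes>\<^sub>M \<rho>)"
    then have A: "A \<in> sets (borel \<Otimes>\<^sub>M borel)" unfolding sets by simp
    have [measurable]: "(\<lambda>(v, q). indicator A (v, q)) \<in> borel_measurable (borel \<Otimes>\<^sub>M borel)"
      using A by (simp add: case_prod_beta')
    have "emeasure (distr M borel V \<Otimes>\<^sub>M \<rho>) A = (\<integral>\<^sup>+v. \<integral>\<^sup>+q. indicator A (v, q) \<partial>\<rho> \<partial>distr M borel V)"
      using A by (subst \<rho>.emeasure_pair_measure) (auto cong: sets_pair_measure_cong)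
    also have "\<dots> = (\<integral>\<^sup>+\<omega>. indicator A (V \<omega>, Q \<omega>) \<partial>M)"
      by (rule nn_integral_joint[symmetric]) measurable
    also have "\<dots> = emeasure (distr M (borel \<Otimes>\<^sub>M borel) (\<lambda>\<omega>. (V \<omega>, Q \<omega>))) A"
      using nn_integral_distr[of "\<lambda>\<omega>. (V \<omega>, Q \<omega>)" M "borel \<Otimes>\<^sub>M borel" "indicator A"] A by simp
    finally show "emeasure (distr M borel V \<Otimes>\<^sub>M \<rho>) A = emeasure (distr M (borel \<Otimes>\<^sub>M borel) (\<lambda>\<omega>. (V \<omega>, Q \<omega>))) A" .
  qed
  then have "distr M (borel \<Otimes>\<^sub>M borel) (\<lambda>\<omega>. (V \<omega>, Q \<omega>)) = distr M borel V \<Otimes>\<^sub>M distr M borel Q"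
    unfolding Q_distr ..
  from pair_distr_compose[OF this V_meas Q_meas f g] show ?thesis
    unfolding indep_var_distribution_eq
    using measurable_compose[OF V_meas f] measurable_compose[OF Q_meas g] by simp
qed

end

end

section \<open>The orbit of a fixed vector under the product\<close>

primrec chain :: "(nat \<Rightarrow> 'a::semiring_1 ^ 'n ^ 'n) \<Rightarrow> 'a ^ 'n \<Rightarrow> nat \<Rightarrow> 'a ^ 'n"
  where
    "chain A e 0 = e"
  | "chain A e (Suc m) = A m *v chain A e m"

lemma matrix_prod_mult_eq_chain: "matrix_prod A m *v e = chain A e m"
  by (induction m) (simp_all add: matrix_vector_mul_assoc[symmetric])

text \<open>At time \<open>m\<close> only factors with index below \<open>m\<close> have acted,
  which is why the orbit is independent of the factor \<open>X m\<close>.\<close>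

lemma chain_cong: "(\<And>k. k < m \<Longrightarrow> A k = B k) \<Longrightarrow> chain A e m = chain B e m"
  by (induction m) auto

locale beta_I_chain = prob_space M
  for M :: "'w measure" and \<nu> :: "'n::finite \<Rightarrow> real"
    and X :: "nat \<Rightarrow> 'w \<Rightarrow> 'a::{real_normed_div_algebra, euclidean_space} ^ 'n ^ 'n" +
  assumes \<nu>_pos: "\<And>l. 0 < \<nu> l"
    and X_iid: "iid_beta_I_matrices M DIM('a) \<nu> X"
begin

lemma indep_X: "indep_vars (\<lambda>_. borel) X UNIV"
  using X_iid by (simp add: iid_beta_I_matrices_def)

lemma X_measurable [measurable]: "X m \<in> borel_measurable M"
  using indep_X by (auto simp: indep_vars_def)

lemma factor: "beta_I_matrix_space M \<nu> (X m)"
proof (intro beta_I_matrix_space.intro beta_I_matrix_space_axioms.intro)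
  show "prob_space M" by unfold_locales
  show "beta_I_matrix M DIM('a) \<nu> (X m)"
    using X_iid by (simp add: iid_beta_I_matrices_def)
qed (use \<nu>_pos in auto)

lemma chain_meas [measurable]: "(\<lambda>\<omega>. chain (\<lambda>i. X i \<omega>) e m) \<in> borel_measurable M"
  by (induction m) auto

lemma indep_chain: "distr M (borel \<Otimes>\<^sub>M borel) (\<lambda>\<omega>. (chain (\<lambda>i. X i \<omega>) e m, X m \<omega>))
  = distr M borel (\<lambda>\<omega>. chain (\<lambda>i. X i \<omega>) e m) \<Otimes>\<^sub>M distr M borel (X m)"
proof -
  \<comment> \<open>The bound \<open>k \<le> m\<close> ensures that the induction evaluates
    \<open>f\<close> only at indices in \<open>{..<m}\<close>.\<close>
  have meas: "(\<lambda>f. chain f e k) \<in> PiM {..<m} (\<lambda>_. borel :: ('a ^ 'n ^ 'n) measure) \<rightarrow>\<^sub>M borel" if "k \<le> m" for k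
    using that
  proof (induction k)
    case (Suc k)
    then have k: "(\<lambda>f. f k) \<in> PiM {..<m} (\<lambda>_. borel :: ('a ^ 'n ^ 'n) measure) \<rightarrow>\<^sub>M borel"
      by (intro measurable_component_singleton) auto
    have "(\<lambda>f. f k *v chain f e k) \<in> PiM {..<m} (\<lambda>_. borel :: ('a ^ 'n ^ 'n) measure) \<rightarrow>\<^sub>M borel"
      using Suc by (intro borel_measurable_matrix_vector_mult k) auto
    then show ?case by simp
  qed simp
  have "indep_var (PiM {..<m} (\<lambda>_. borel)) (\<lambda>\<omega>. restrict (\<lambda>i. X i \<omega>) {..<m})
      (PiM {m} (\<lambda>_. borel)) (\<lambda>\<omega>. restrict (\<lambda>i. X i \<omega>) {m})"
    by (rule indep_var_restrict[OF indep_X]) auto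
  then have "distr M (PiM {..<m} (\<lambda>_. borel) \<Otimes>\<^sub>M PiM {m} (\<lambda>_. borel))
        (\<lambda>\<omega>. (restrict (\<lambda>i. X i \<omega>) {..<m}, restrict (\<lambda>i. X i \<omega>) {m}))
      = distr M (PiM {..<m} (\<lambda>_. borel)) (\<lambda>\<omega>. restrict (\<lambda>i. X i \<omega>) {..<m})
        \<Otimes>\<^sub>M distr M (PiM {m} (\<lambda>_. borel)) (\<lambda>\<omega>. restrict (\<lambda>i. X i \<omega>) {m})"
    and "(\<lambda>\<omega>. restrict (\<lambda>i. X i \<omega>) {..<m}) \<in> M \<rightarrow>\<^sub>M PiM {..<m} (\<lambda>_. borel)"
    and "(\<lambda>\<omega>. restrict (\<lambda>i. X i \<omega>) {m}) \<in> M \<rightarrow>\<^sub>M PiM {m} (\<lambda>_. borel)"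
    by (simp_all add: indep_var_distribution_eq)
  from pair_distr_compose[OF this meas[OF order_refl] measurable_component_singleton[of m]]
  have "distr M (borel \<Otimes>\<^sub>M borel) (\<lambda>\<omega>. (chain (restrict (\<lambda>i. X i \<omega>) {..<m}) e m, X m \<omega>))
      = distr M borel (\<lambda>\<omega>. chain (restrict (\<lambda>i. X i \<omega>) {..<m}) e m) \<Otimes>\<^sub>M distr M borel (X m)"
    by simp
  moreover have "chain (restrict (\<lambda>i. X i \<omega>) {..<m}) e m = chain (\<lambda>i. X i \<omega>) e m" for \<omega>
    by (rule chain_cong) simp
  ultimately show ?thesis by simp
qed

context
  fixes e :: "'a ^ 'n"
  assumes e: "norm e = 1"
begin

definition step_sq :: "nat \<Rightarrow> 'w \<Rightarrow> real"
  where "step_sq m \<omega> = (norm (X m \<omega> *v normalize_vec e (chain (\<lambda>i. X i \<omega>) e m)))\<^sup>2"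

definition sq_law :: "real measure"
  where "sq_law = distr M borel (\<lambda>\<omega>. (norm (X 0 \<omega> *v e))\<^sup>2)"

lemma sq_law: "distr M borel (\<lambda>\<omega>. (norm (X m \<omega> *v e))\<^sup>2) = sq_law"
  unfolding sq_law_def beta_I_matrix_space.norm_sq_distr[OF factor e, where i = undefined] ..

lemma step_sq_distr: "distr M borel (step_sq m) = sq_law"
  using beta_I_matrix_space.Q_distr[OF factor chain_meas indep_chain[where m = m] e]
  unfolding sq_law step_sq_def[abs_def] .

lemma indep_step_sq:
  fixes f :: "'a ^ 'n \<Rightarrow> real" and g :: "real \<Rightarrow> real"
  assumes "f \<in> borel_measurable borel" "g \<in> borel_measurable borel"
  shows "indep_var borel (\<lambda>\<omega>. f (chain (\<lambda>i. X i \<omega>) e m)) borel (\<lambda>\<omega>. g (step_sq m \<omega>))"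
  using beta_I_matrix_space.indep_V_Q[OF factor chain_meas indep_chain[where m = m] e assms]
  unfolding step_sq_def[abs_def] .

lemma step_sq_meas [measurable]: "step_sq m \<in> borel_measurable M"
  using beta_I_matrix_space.Q_meas[OF factor chain_meas indep_chain[where m = m] e]
  unfolding step_sq_def[abs_def] .

lemma AE_step_sq: "AE \<omega> in M. \<forall>m. 0 < step_sq m \<omega>"
proof -
  have "AE x in sq_law. 0 < x"
    unfolding sq_law_def using beta_I_matrix_space.AE_norm_sq[OF factor e, of 0]
    by (subst AE_distr_iff) auto
  then have "AE x in distr M borel (step_sq m). 0 < x" for m by (simp only: step_sq_distr)
  then have "AE \<omega> in M. 0 < step_sq m \<omega>" for m by (subst (asm) AE_distr_iff) auto
  then show ?thesis by (simp add: AE_all_countable)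
qed

text \<open>Positivity of all steps keeps the orbit away from 0 by induction. The default in
  \<open>normalize_vec\<close> then never occurs along the orbit, and homogeneity makes the
  logarithms additive.\<close>

lemma AE_chain: "AE \<omega> in M. \<forall>m. chain (\<lambda>i. X i \<omega>) e m \<noteq> 0 \<and>
    ln ((norm (chain (\<lambda>i. X i \<omega>) e (Suc m)))\<^sup>2) = ln ((norm (chain (\<lambda>i. X i \<omega>) e m))\<^sup>2) + ln (step_sq m \<omega>)"
  using AE_step_sq
proof (rule AE_mp, intro AE_I2 impI allI)
  fix \<omega> m assume pos: "\<forall>m. 0 < step_sq m \<omega>"
  define c where "c = chain (\<lambda>i. X i \<omega>) e"
  have step: "(norm (c (Suc m)))\<^sup>2 = (norm (c m))\<^sup>2 * step_sq m \<omega>" if "c m \<noteq> 0" for m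
  proof -
    have "c m = norm (c m) *\<^sub>R normalize_vec e (c m)" using that by (simp add: normalize_vec_def)
    then have "X m \<omega> *v c m = norm (c m) *\<^sub>R (X m \<omega> *v normalize_vec e (c m))"
      by (metis matrix_vector_mult_scaleR_right)
    then have "norm (c (Suc m)) = norm (c m) * norm (X m \<omega> *v normalize_vec e (c m))"
      by (simp add: c_def)
    then show ?thesis by (simp add: step_sq_def c_def power_mult_distrib)
  qed
  have nz: "c m \<noteq> 0" for m
  proof (induction m)
    case 0
    then show ?case using e by (auto simp: c_def)
  next
    case (Suc m)
    then have "0 < (norm (c m))\<^sup>2 * step_sq m \<omega>" using pos by simp
    then show ?case using step[OF Suc] by auto
  qed
  have "ln ((norm (c (Suc m)))\<^sup>2) = ln ((norm (c m))\<^sup>2) + ln (step_sq m \<omega>)"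
    unfolding step[OF nz] using nz pos by (subst ln_mult_pos) auto
  then show "chain (\<lambda>i. X i \<omega>) e m \<noteq> 0 \<and>
    ln ((norm (chain (\<lambda>i. X i \<omega>) e (Suc m)))\<^sup>2) = ln ((norm (chain (\<lambda>i. X i \<omega>) e m))\<^sup>2) + ln (step_sq m \<omega>)"
    using nz by (simp add: c_def)
qed

definition mean_log :: real
  where "mean_log = (\<integral>x. ln x \<partial>sq_law)"

lemma integral_step_sq:
  fixes f :: "real \<Rightarrow> real"
  assumes [measurable]: "f \<in> borel_measurable borel"
  shows "expectation (\<lambda>\<omega>. f (step_sq m \<omega>)) = (\<integral>x. f x \<partial>sq_law)"
    and "integrable M (\<lambda>\<omega>. f (step_sq m \<omega>)) \<longleftrightarrow> integrable sq_law f"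
  unfolding step_sq_distr[of m, symmetric]
  by (simp_all add: integral_distr integrable_distr_eq)

lemma integrable_sq_law: "integrable sq_law (\<lambda>x. ln x ^ 4)" "integrable sq_law ln"
proof -
  have "integrable M (\<lambda>\<omega>. ln ((norm (X 0 \<omega> *v e))\<^sup>2) ^ 4)"
    by (rule beta_I_matrix_space.integrable_ln_norm_sq_power4[OF factor e])
  then show *: "integrable sq_law (\<lambda>x. ln x ^ 4)"
    unfolding sq_law_def by (subst integrable_distr_eq) auto
  interpret L: prob_space sq_law
    unfolding sq_law_def by (rule prob_space_distr) measurable
  have "ln \<in> borel_measurable sq_law"
    by (simp add: sq_law_def)
  from L.integrable_power_le[OF this *, of 1] show "integrable sq_law ln" by simp
qed

text \<open>The centred logarithm of the squared norm is the partial sum in the strong law; the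
  squares account for the factor \<open>1/2\<close>.\<close>

lemma AE_chain_growth:
  "AE \<omega> in M. (\<forall>m. chain (\<lambda>i. X i \<omega>) e m \<noteq> 0) \<and>
    (\<lambda>m. ln (norm (chain (\<lambda>i. X i \<omega>) e m)) / real m) \<longlonglongrightarrow> mean_log / 2"
proof -
  define S where "S m \<omega> = ln ((norm (chain (\<lambda>i. X i \<omega>) e m))\<^sup>2) - real m * mean_log" for m \<omega>
  define Z where "Z m \<omega> = ln (step_sq m \<omega>) - mean_log" for m \<omega>
  interpret L: prob_space sq_law
    unfolding sq_law_def by (rule prob_space_distr) measurable
  have ln_int: "integrable M (\<lambda>\<omega>. ln (step_sq m \<omega>))" for m
    using integrable_sq_law(2) by (subst integral_step_sq(2)) auto
  have Z4: "integrable sq_law (\<lambda>x. (ln x - mean_log) ^ 4)"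
  proof (rule Bochner_Integration.integrable_bound)
    show "integrable sq_law (\<lambda>x. 8 * (ln x ^ 4 + mean_log ^ 4))"
      using integrable_sq_law(1) by auto
    \<comment> \<open>Squaring \<open>(x - y)^2 \<le> 2 (x^2 + y^2)\<close> and applying the
      companion bound for sums to the squares gives \<open>4 * 2 = 8\<close>.\<close>
    have le: "(x - y) ^ 4 \<le> 8 * (x ^ 4 + y ^ 4)" for x y :: real
    proof -
      have sq: "(a - b)\<^sup>2 \<le> 2 * (a\<^sup>2 + b\<^sup>2)" "(a + b)\<^sup>2 \<le> 2 * (a\<^sup>2 + b\<^sup>2)" for a b :: real
        using zero_le_power2[of "a + b"] zero_le_power2[of "a - b"]
        by (simp_all add: power2_eq_square algebra_simps)
      have p4: "z ^ 4 = (z\<^sup>2)\<^sup>2" for z :: real by simp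
      have "(x - y) ^ 4 \<le> (2 * (x\<^sup>2 + y\<^sup>2))\<^sup>2"
        unfolding p4 using sq(1)[of x y] by (intro power_mono) auto
      also have "\<dots> = 4 * (x\<^sup>2 + y\<^sup>2)\<^sup>2" by (simp only: power_mult_distrib) simp
      also have "\<dots> \<le> 8 * (x ^ 4 + y ^ 4)" using sq(2)[of "x\<^sup>2" "y\<^sup>2"] unfolding p4 by linarith
      finally show ?thesis .
    qed
    show "AE x in sq_law. norm ((ln x - mean_log) ^ 4) \<le> norm (8 * (ln x ^ 4 + mean_log ^ 4))"
      using le by (intro AE_I2) simp
  qed (simp add: sq_law_def)
  have "AE \<omega> in M. (\<lambda>m. S m \<omega> / real m) \<longlonglongrightarrow> 0"
  proof (rule strong_law_fourth_moment[where Z = Z and B = "\<integral>x. (ln x - mean_log) ^ 4 \<partial>sq_law"])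
    show "S 0 \<omega> = 0" for \<omega> by (simp add: S_def e)
    show "AE \<omega> in M. S (Suc m) \<omega> = S m \<omega> + Z m \<omega>" for m
      using AE_chain by eventually_elim (simp add: S_def Z_def algebra_simps del: chain.simps)
    \<comment> \<open>\<open>S m\<close> is a function of the current orbit vector alone, so its
      independence from the next step suffices.\<close>
    show "indep_var borel (S m) borel (Z m)" for m
      unfolding S_def[abs_def] Z_def[abs_def]
      by (rule indep_step_sq[where f = "\<lambda>v. ln ((norm v)\<^sup>2) - real m * mean_log"
            and g = "\<lambda>x. ln x - mean_log"]) measurable
    show "expectation (Z m) = 0" for m
      using ln_int[of m] integral_step_sq(1)[of ln m]
      by (simp add: Z_def[abs_def] prob_space mean_log_def)
    show "integrable M (\<lambda>\<omega>. Z m \<omega> ^ 4)" for m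
      unfolding Z_def using Z4 by (subst integral_step_sq(2)) auto
    show "expectation (\<lambda>\<omega>. Z m \<omega> ^ 4) \<le> (\<integral>x. (ln x - mean_log) ^ 4 \<partial>sq_law)" for m
      unfolding Z_def by (subst integral_step_sq(1)) auto
  qed
  with AE_chain show ?thesis
  proof eventually_elim
    fix \<omega>
    assume nz: "\<forall>m. chain (\<lambda>i. X i \<omega>) e m \<noteq> 0 \<and> ln ((norm (chain (\<lambda>i. X i \<omega>) e (Suc m)))\<^sup>2)
        = ln ((norm (chain (\<lambda>i. X i \<omega>) e m))\<^sup>2) + ln (step_sq m \<omega>)"
      and lim: "(\<lambda>m. S m \<omega> / real m) \<longlonglongrightarrow> 0"
    have "(\<lambda>m. (S m \<omega> / real m + mean_log) / 2) \<longlonglongrightarrow> (0 + mean_log) / 2"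
      by (intro tendsto_intros lim) auto
    moreover have "\<forall>\<^sub>F m in sequentially. (S m \<omega> / real m + mean_log) / 2 = ln (norm (chain (\<lambda>i. X i \<omega>) e m)) / real m"
      using eventually_gt_at_top[of 0]
    proof eventually_elim
      fix m :: nat assume "0 < m"
      moreover have "ln ((norm (chain (\<lambda>i. X i \<omega>) e m))\<^sup>2) = 2 * ln (norm (chain (\<lambda>i. X i \<omega>) e m))"
        using nz by (simp add: ln_realpow)
      ultimately show "(S m \<omega> / real m + mean_log) / 2 = ln (norm (chain (\<lambda>i. X i \<omega>) e m)) / real m"
        by (simp add: S_def field_simps)
    qed
    ultimately have "(\<lambda>m. ln (norm (chain (\<lambda>i. X i \<omega>) e m)) / real m) \<longlonglongrightarrow> (0 + mean_log) / 2"
      by (rule Lim_transform_eventually)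
    then show "(\<forall>m. chain (\<lambda>i. X i \<omega>) e m \<noteq> 0) \<and>
        (\<lambda>m. ln (norm (chain (\<lambda>i. X i \<omega>) e m)) / real m) \<longlonglongrightarrow> mean_log / 2"
      using nz by simp
  qed
qed

end

end

section \<open>Growth rate\<close>

text \<open>\<open>A *v y\<close> is the sum of the columns of \<open>A\<close>, each multiplied on
  the right by an entry of \<open>y\<close>, and the norm is multiplicative.\<close>

lemma norm_matrix_vector_mult_le:
  fixes A :: "'a::{real_normed_div_algebra, euclidean_space} ^ 'n ^ 'm"
  shows "norm (A *v y) \<le> (\<Sum>j\<in>UNIV. norm (A *v axis j 1) * norm (y $ j))"
proof -
  have col: "(A *v axis j 1) $ i = A $ i $ j" for i j
    by (simp add: matrix_vector_mult_def axis_def if_distrib[where f = "\<lambda>z. _ * z"] cong: if_cong)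
  have "A *v y = (\<Sum>j\<in>UNIV. (\<chi> i. (A *v axis j 1) $ i * y $ j))"
    by (simp add: vec_eq_iff col) (simp add: matrix_vector_mult_def)
  then have "norm (A *v y) \<le> (\<Sum>j\<in>UNIV. norm (\<chi> i. (A *v axis j 1) $ i * y $ j))"
    by (simp only: norm_sum)
  also have "\<dots> = (\<Sum>j\<in>UNIV. norm (A *v axis j 1) * norm (y $ j))"
  proof (rule sum.cong[OF refl])
    fix j
    have "(norm (\<chi> i. (A *v axis j 1) $ i * y $ j))\<^sup>2 = (norm (A *v axis j 1) * norm (y $ j))\<^sup>2"
      by (simp add: power2_norm_vec norm_mult power_mult_distrib sum_distrib_right)
    then show "norm (\<chi> i. (A *v axis j 1) $ i * y $ j) = norm (A *v axis j 1) * norm (y $ j)"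
      by (simp add: power2_eq_iff_nonneg)
  qed
  finally show ?thesis .
qed

text \<open>A deterministic statement, so one null set serves all \<open>y\<close>. A basis vector
  attains \<open>\<mu>\<close>; every other \<open>y\<close> grows at most like
  \<open>C * exp (m (\<mu> + \<epsilon>))\<close>, where \<open>C\<close> depends on
  \<open>y\<close> but disappears after division by \<open>m\<close>.\<close>

lemma max_growth_rate_eq:
  fixes A :: "nat \<Rightarrow> 'a::{real_normed_div_algebra, euclidean_space} ^ 'n ^ 'n"
  assumes nz: "\<And>j m. chain A (axis j 1) m \<noteq> 0"
    and lim: "\<And>j. (\<lambda>m. ln (norm (chain A (axis j 1) m)) / real m) \<longlonglongrightarrow> \<mu>"
  shows "max_growth_rate A = ereal \<mu>"
  unfolding max_growth_rate_def
proof (rule antisym)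
  have "(\<lambda>m. log_norm (matrix_prod A m *v axis j 1) / ereal (real m)) \<longlonglongrightarrow> ereal \<mu>" for j
  proof (rule Lim_transform_eventually)
    show "(\<lambda>m. ereal (ln (norm (chain A (axis j 1) m)) / real m)) \<longlonglongrightarrow> ereal \<mu>"
      using lim by simp
    show "\<forall>\<^sub>F m in sequentially. ereal (ln (norm (chain A (axis j 1) m)) / real m)
        = log_norm (matrix_prod A m *v axis j 1) / ereal (real m)"
      using eventually_gt_at_top[of 0]
      by eventually_elim (simp add: matrix_prod_mult_eq_chain log_norm_def nz)
  qed
  moreover have "axis j (1::'a) \<noteq> 0" for j :: 'n by (simp add: axis_eq_0_iff)
  ultimately show "ereal \<mu> \<le> Sup {L. \<exists>y. y \<noteq> 0 \<and> (\<lambda>m. log_norm (matrix_prod A m *v y) / ereal (real m)) \<longlonglongrightarrow> L}"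
    by (intro Sup_upper) blast
  show "Sup {L. \<exists>y. y \<noteq> 0 \<and> (\<lambda>m. log_norm (matrix_prod A m *v y) / ereal (real m)) \<longlonglongrightarrow> L} \<le> ereal \<mu>"
  proof (rule Sup_least, clarify)
    fix L and y :: "'a ^ 'n"
    assume y: "y \<noteq> 0" and L: "(\<lambda>m. log_norm (matrix_prod A m *v y) / ereal (real m)) \<longlonglongrightarrow> L"
    define C where "C = (\<Sum>j\<in>UNIV. norm (y $ j))"
    obtain j0 where "y $ j0 \<noteq> 0" using y by (auto simp: vec_eq_iff)
    then have C: "0 < C"
      unfolding C_def by (intro sum_pos2[of _ j0]) auto
    have "L \<le> ereal \<mu> + ereal \<epsilon>" if \<epsilon>: "0 < \<epsilon>" for \<epsilon>
    proof (rule tendsto_le[OF _ _ L])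
      have "(\<lambda>m. ln C / real m + (\<mu> + \<epsilon>)) \<longlonglongrightarrow> 0 + (\<mu> + \<epsilon>)"
        by (intro tendsto_intros lim_const_over_n)
      then show "(\<lambda>m. ereal (ln C / real m + (\<mu> + \<epsilon>))) \<longlonglongrightarrow> ereal \<mu> + ereal \<epsilon>" by simp
      have "\<forall>\<^sub>F m in sequentially. \<forall>j. ln (norm (chain A (axis j 1) m)) / real m < \<mu> + \<epsilon>"
        using order_tendstoD(2)[OF lim, of "\<mu> + \<epsilon>"] \<epsilon> by (intro eventually_all_finite) simp
      then show "\<forall>\<^sub>F m in sequentially. log_norm (matrix_prod A m *v y) / ereal (real m)
          \<le> ereal (ln C / real m + (\<mu> + \<epsilon>))"
        using eventually_gt_at_top[of 0]
      proof eventually_elim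
        fix m :: nat
        assume *: "\<forall>j. ln (norm (chain A (axis j 1) m)) / real m < \<mu> + \<epsilon>" and m: "0 < m"
        have le: "norm (matrix_prod A m *v axis j 1) \<le> exp (real m * (\<mu> + \<epsilon>))" for j
        proof -
          have "ln (norm (chain A (axis j 1) m)) \<le> real m * (\<mu> + \<epsilon>)"
            using *[rule_format, of j] m by (simp add: field_simps)
          then have "exp (ln (norm (chain A (axis j 1) m))) \<le> exp (real m * (\<mu> + \<epsilon>))" by simp
          then show ?thesis using nz[of j m] by (simp add: matrix_prod_mult_eq_chain)
        qed
        have "norm (matrix_prod A m *v y) \<le> (\<Sum>j\<in>UNIV. norm (matrix_prod A m *v axis j 1) * norm (y $ j))"
          by (rule norm_matrix_vector_mult_le)
        also have "\<dots> \<le> (\<Sum>j\<in>UNIV. exp (real m * (\<mu> + \<epsilon>)) * norm (y $ j))"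
          by (intro sum_mono mult_right_mono le) auto
        also have "\<dots> = exp (real m * (\<mu> + \<epsilon>)) * C"
          by (simp add: C_def sum_distrib_left)
        finally have n: "norm (matrix_prod A m *v y) \<le> exp (real m * (\<mu> + \<epsilon>)) * C" .
        show "log_norm (matrix_prod A m *v y) / ereal (real m) \<le> ereal (ln C / real m + (\<mu> + \<epsilon>))"
        proof (cases "matrix_prod A m *v y = 0")
          \<comment> \<open>Here \<open>log_norm\<close> is minus infinity, so the bound is
            immediate.\<close>
          case True
          then show ?thesis using m by (simp add: log_norm_def)
        next
          case False
          then have "ln (norm (matrix_prod A m *v y)) \<le> ln (exp (real m * (\<mu> + \<epsilon>)) * C)"
            using n C by (subst ln_le_cancel_iff) auto
          also have "\<dots> = real m * (\<mu> + \<epsilon>) + ln C"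
            using C by (simp add: ln_mult_pos)
          finally have "ln (norm (matrix_prod A m *v y)) / real m \<le> (real m * (\<mu> + \<epsilon>) + ln C) / real m"
            using m by (intro divide_right_mono) auto
          also have "\<dots> = ln C / real m + (\<mu> + \<epsilon>)" using m by (simp add: add_divide_distrib)
          finally show ?thesis using False m by (simp add: log_norm_def)
        qed
      qed
    qed simp
    then show "L \<le> ereal \<mu>" by (rule ereal_le_epsilon2)
  qed
qed

text \<open>All three number systems are covered, with \<open>DIM('a)\<close> in the role of
  \<open>\<beta>\<close>. Integrability is asserted separately because the integral of a
  non-integrable function is 0 by convention.\<close>

lemma (in beta_I_chain) lyapunov_exponent_formula:
  "\<exists>\<mu>. has_largest_lyapunov_exponent M X \<mu> \<and>
    set_integrable lborel {0<..} (lyapunov_integrand DIM('a) \<nu>) \<and>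
    2 * \<mu> = (LBINT t:{0<..}. lyapunov_integrand DIM('a) \<nu> t)"
proof -
  let ?e = "\<lambda>j. axis j (1::'a) :: 'a ^ 'n"
  have e: "norm (?e j) = 1" for j
    by (simp add: norm_eq_sqrt_inner inner_axis_axis) (simp add: power2_norm_eq_inner[symmetric])
  define e where "e = ?e undefined"
  have e1: "norm e = 1" unfolding e_def by (rule e)
  \<comment> \<open>All basis vectors share one step law, hence one limit, so the arbitrary choice
    of \<open>e\<close> does not matter.\<close>
  have law: "sq_law (?e j) = sq_law e" for j
    unfolding sq_law_def[OF e] sq_law_def[OF e1]
      beta_I_matrix_space.norm_sq_distr[OF factor e, where i = undefined]
      beta_I_matrix_space.norm_sq_distr[OF factor e1, where i = undefined] ..
  have mean: "mean_log (?e j) = mean_log e" for j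
    unfolding mean_log_def[OF e] mean_log_def[OF e1] law ..
  have "AE \<omega> in M. \<forall>j. (\<forall>m. chain (\<lambda>i. X i \<omega>) (?e j) m \<noteq> 0) \<and>
    (\<lambda>m. ln (norm (chain (\<lambda>i. X i \<omega>) (?e j) m)) / real m) \<longlonglongrightarrow> mean_log e / 2"
    using AE_chain_growth[OF e] unfolding mean by (simp add: AE_all_countable)
  then have "AE \<omega> in M. max_growth_rate (\<lambda>i. X i \<omega>) = ereal (mean_log e / 2)"
    by eventually_elim (intro max_growth_rate_eq, auto)
  then have exponent: "has_largest_lyapunov_exponent M X (mean_log e / 2)"
    by (simp add: has_largest_lyapunov_exponent_def)
  define W where "W \<omega> = (norm (X 0 \<omega> *v e))\<^sup>2" for \<omega>
  have W [measurable]: "W \<in> borel_measurable M" unfolding W_def[abs_def] by measurable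
  have W_pos: "AE \<omega> in M. 0 < W \<omega>"
    using beta_I_matrix_space.AE_norm_sq[OF factor e1, of 0] unfolding W_def by eventually_elim simp
  have sq_law: "sq_law e = distr M borel W"
    unfolding sq_law_def[OF e1] W_def[abs_def] ..
  have W_ln: "integrable M (\<lambda>\<omega>. ln (W \<omega>))"
    using integrable_sq_law(2)[OF e1] unfolding sq_law by (subst (asm) integrable_distr_eq) auto
  have W_mean: "mean_log e = expectation (\<lambda>\<omega>. ln (W \<omega>))"
    unfolding mean_log_def[OF e1] sq_law by (subst integral_distr) auto
  have integrand: "(exp (- t) - expectation (\<lambda>\<omega>. exp (- t * W \<omega>))) / t = lyapunov_integrand DIM('a) \<nu> t"
    if "t \<in> {0<..}" for t
  proof -
    \<comment> \<open>Identifies \<open>\<beta>/2 + \<alpha>_l\<close> with the parameter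
      \<open>\<beta> (N + \<nu>_l) / 2\<close> that arises from the row moments.\<close>
    have param: "DIM('a) / 2 + DIM('a) * (real CARD('n) + \<nu> l - 1) / 2 = DIM('a) * (real CARD('n) + \<nu> l) / 2" for l
      by (simp add: field_simps)
    have "expectation (\<lambda>\<omega>. exp (- t * W \<omega>))
        = (\<Prod>l\<in>UNIV. hyp_1F1 (DIM('a) / 2) (DIM('a) * (real CARD('n) + \<nu> l) / 2) (- t))"
      unfolding W_def using that by (intro beta_I_matrix_space.norm_sq_laplace[OF factor e1]) auto
    then show ?thesis by (simp only: lyapunov_integrand_def Let_def param)
  qed
  have "set_integrable lborel {0<..} (lyapunov_integrand DIM('a) \<nu>)"
    using expectation_ln_eq_frullani_integral(1)[OF W W_pos W_ln]
    by (subst (asm) set_integrable_cong[OF refl refl integrand]) auto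
  moreover have "mean_log e = (LBINT t:{0<..}. lyapunov_integrand DIM('a) \<nu> t)"
    unfolding W_mean expectation_ln_eq_frullani_integral(2)[OF W W_pos W_ln]
    by (rule set_lebesgue_integral_cong) (simp, intro allI impI integrand)
  ultimately show ?thesis
    using exponent by (intro exI[of _ "mean_log e / 2"]) simp
qed

theorem proposition11:
  fixes M :: "'w measure" and \<nu> :: "'n::finite \<Rightarrow> real"
  assumes "prob_space M" and "\<And>l. 0 < \<nu> l"
  shows
    "(\<forall>X :: nat \<Rightarrow> 'w \<Rightarrow> real ^ 'n ^ 'n. iid_beta_I_matrices M 1 \<nu> X \<longrightarrow>
        (\<exists>\<mu>\<^sub>1. has_largest_lyapunov_exponent M X \<mu>\<^sub>1 \<and>
          set_integrable lborel {0<..} (lyapunov_integrand 1 \<nu>) \<and>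
          2 * \<mu>\<^sub>1 = (LBINT t:{0<..}. lyapunov_integrand 1 \<nu> t)))
   \<and> (\<forall>X :: nat \<Rightarrow> 'w \<Rightarrow> complex ^ 'n ^ 'n. iid_beta_I_matrices M 2 \<nu> X \<longrightarrow>
        (\<exists>\<mu>\<^sub>1. has_largest_lyapunov_exponent M X \<mu>\<^sub>1 \<and>
          set_integrable lborel {0<..} (lyapunov_integrand 2 \<nu>) \<and>
          2 * \<mu>\<^sub>1 = (LBINT t:{0<..}. lyapunov_integrand 2 \<nu> t)))
   \<and> (\<forall>X :: nat \<Rightarrow> 'w \<Rightarrow> quat ^ 'n ^ 'n. iid_beta_I_matrices M 4 \<nu> X \<longrightarrow>
        (\<exists>\<mu>\<^sub>1. has_largest_lyapunov_exponent M X \<mu>\<^sub>1 \<and>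
          set_integrable lborel {0<..} (lyapunov_integrand 4 \<nu>) \<and>
          2 * \<mu>\<^sub>1 = (LBINT t:{0<..}. lyapunov_integrand 4 \<nu> t)))"
proof (intro conjI allI impI)
  fix X :: "nat \<Rightarrow> 'w \<Rightarrow> real ^ 'n ^ 'n"
  assume "iid_beta_I_matrices M 1 \<nu> X"
  then show "\<exists>\<mu>\<^sub>1. has_largest_lyapunov_exponent M X \<mu>\<^sub>1 \<and>
          set_integrable lborel {0<..} (lyapunov_integrand 1 \<nu>) \<and>
          2 * \<mu>\<^sub>1 = (LBINT t:{0<..}. lyapunov_integrand 1 \<nu> t)"
    \<comment> \<open>Here \<open>DIM('a)\<close> evaluates to 1; in the complex and quaternion
      cases it evaluates to 2 and 4.\<close>
    using beta_I_chain.lyapunov_exponent_formula[of M \<nu> X] assms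
    by (simp add: beta_I_chain_def beta_I_chain_axioms_def)
next
  fix X :: "nat \<Rightarrow> 'w \<Rightarrow> complex ^ 'n ^ 'n"
  assume "iid_beta_I_matrices M 2 \<nu> X"
  then show "\<exists>\<mu>\<^sub>1. has_largest_lyapunov_exponent M X \<mu>\<^sub>1 \<and>
          set_integrable lborel {0<..} (lyapunov_integrand 2 \<nu>) \<and>
          2 * \<mu>\<^sub>1 = (LBINT t:{0<..}. lyapunov_integrand 2 \<nu> t)"
    using beta_I_chain.lyapunov_exponent_formula[of M \<nu> X] assms
    by (simp add: beta_I_chain_def beta_I_chain_axioms_def)
next
  fix X :: "nat \<Rightarrow> 'w \<Rightarrow> quat ^ 'n ^ 'n"
  assume "iid_beta_I_matrices M 4 \<nu> X"
  then show "\<exists>\<mu>\<^sub>1. has_largest_lyapunov_exponent M X \<mu>\<^sub>1 \<and>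
          set_integrable lborel {0<..} (lyapunov_integrand 4 \<nu>) \<and>
          2 * \<mu>\<^sub>1 = (LBINT t:{0<..}. lyapunov_integrand 4 \<nu> t)"
    using beta_I_chain.lyapunov_exponent_formula[of M \<nu> X] assms
    by (simp add: beta_I_chain_def beta_I_chain_axioms_def)
qed

end
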